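(* Let $p\in(0,1]$, $q\in[p,1]$, and let $\mathcal B_q$ be a $q$-quasi-Banach space. Let $s_1,s_2\in\mathbb Z_+$ and, for $i=1,2$, $\sigma_i\in(\max\{n_i/p,\,n_i+s_i\},\,n_i+s_i+1)$. Let $T$ be a $\mathcal B_q$-sublinear operator from $\mathcal D_{s_1,s_2}(\mathbb R^{n_1}\times\mathbb R^{n_2})$ to $\mathcal B_q$. Suppose there exists $C>0$ such that for all $f\in\mathcal D_{s_1,s_2}(\mathbb R^{n_1}\times\mathbb R^{n_2})$, $$\|Tf\|_{\mathcal B_q}\le C\Big[\sup_{x_2\in\mathbb R^{n_2}}\operatorname{diam}(\operatorname{supp}f(\cdot,x_2))\Big]^{n_1/p}\Big[\sup_{x_1\in\mathbb R^{n_1}}\operatorname{diam}(\operatorname{supp}f(x_1,\cdot))\Big]^{n_2/p}\|f\|_{L^\infty}.$$ Then there exists $C'>0$ such that $\|Tf\|_{\mathcal B_q}\le C'\|f\|_{\mathcal D_{s_1,s_2;\sigma_1,\sigma_2}}$ for all $f\in\mathcal D_{s_1,s_2}(\mathbb R^{n_1}\times\mathbb R^{n_2})$; i.e. $T$ extends to a bounded $\mathcal B_q$-sublinear operator from $\mathcal D_{s_1,s_2;\sigma_1,\sigma_2}(\mathbb R^{n_1}\times\mathbb R^{n_2})$ to $\mathcal B_q$.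
   Context: $\mathcal D_{s_1,s_2}(\mathbb R^{n_1}\times\mathbb R^{n_2})$ is the set of smooth compactly supported $f$ on $\mathbb R^{n_1}\times\mathbb R^{n_2}$ with $\int_{\mathbb R^{n_1}}f(x_1,x_2)x_1^{\alpha_1}dx_1=0$ for all $x_2$, $|\alpha_1|\le s_1$, and $\int_{\mathbb R^{n_2}}f(x_1,x_2)x_2^{\alpha_2}dx_2=0$ for all $x_1$, $|\alpha_2|\le s_2$. $\mathcal D_{s_1,s_2;\sigma_1,\sigma_2}$ denotes this space with the norm $\|f\|_{\mathcal D_{s_1,s_2;\sigma_1,\sigma_2}}=\sup_{x_1,x_2}(1+|x_1|)^{\sigma_1}(1+|x_2|)^{\sigma_2}|f(x_1,x_2)|$. Here $\sup_{x_2}\operatorname{diam}(\operatorname{supp}f(\cdot,x_2))=\sup\{|x_1-y_1|: x_2\in\mathbb R^{n_2},\ f(x_1,x_2)\ne0,\ f(y_1,x_2)\ne0\}$, and $\sup_{x_1}\operatorname{diam}(\operatorname{supp}f(x_1,\cdot))$ is defined symmetrically. A $q$-quasi-Banach space ($q\in(0,1]$) is a quasi-Banach space $\mathcal B_q$ whose quasi-norm satisfies $\|f+g\|^q_{\mathcal B_q}\le\|f\|^q_{\mathcal B_q}+\|g\|^q_{\mathcal B_q}$. An operator $T$ from a linear space $\mathcal Y$ into $\mathcal B_q$ is $\mathcal B_q$-sublinear if for all $f,g\in\mathcal Y$ and $\lambda,\nu\in\mathbb C$: $\|T(\lambda f+\nu g)\|_{\mathcal B_q}\le(|\lambda|^q\|Tf\|^q_{\mathcal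 B_q}+|\nu|^q\|Tg\|^q_{\mathcal B_q})^{1/q}$ and $\|Tf-Tg\|_{\mathcal B_q}\le\|T(f-g)\|_{\mathcal B_q}$. *)

theory Defs
  imports "HOL-Analysis.Analysis"
begin

fun Ck :: "nat \<Rightarrow> ('c::euclidean_space \<Rightarrow> complex) \<Rightarrow> bool" where
  "Ck 0 g = continuous_on UNIV g"
| "Ck (Suc k) g = (\<exists>g'. (\<forall>x. (g has_derivative g' x) (at x)) \<and> (\<forall>v. Ck k (\<lambda>x. g' x v)))"

definition smooth :: "('c::euclidean_space \<Rightarrow> complex) \<Rightarrow> bool" where
  "smooth g \<longleftrightarrow> (\<forall>k. Ck k g)"

definition monom_ml :: "('c::euclidean_space \<Rightarrow> nat) \<Rightarrow> 'c \<Rightarrow> real" where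
  "monom_ml \<alpha> x = (\<Prod>i\<in>Basis. (x \<bullet> i) ^ (\<alpha> i))"

definition mi_order :: "('c::euclidean_space \<Rightarrow> nat) \<Rightarrow> nat" where
  "mi_order \<alpha> = (\<Sum>i\<in>Basis. \<alpha> i)"

definition Dspace :: "nat \<Rightarrow> nat \<Rightarrow> ('a::euclidean_space \<Rightarrow> 'b::euclidean_space \<Rightarrow> complex) set" where
  "Dspace s1 s2 = {f.
     smooth (\<lambda>z. f (fst z) (snd z)) \<and>
     compact (closure {z. f (fst z) (snd z) \<noteq> 0}) \<and>
     (\<forall>x2 \<alpha>. mi_order \<alpha> \<le> s1 \<longrightarrow>
        (LINT x1|lborel. f x1 x2 * complex_of_real (monom_ml \<alpha> x1)) = 0) \<and>
     (\<forall>x1 \<alpha>. mi_order \<alpha> \<le> s2 \<longrightarrow>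
        (LINT x2|lborel. f x1 x2 * complex_of_real (monom_ml \<alpha> x2)) = 0)}"

definition Dnorm :: "real \<Rightarrow> real \<Rightarrow> ('a::euclidean_space \<Rightarrow> 'b::euclidean_space \<Rightarrow> complex) \<Rightarrow> real" where
  "Dnorm \<sigma>1 \<sigma>2 f = (SUP z. (1 + norm (fst z)) powr \<sigma>1 * (1 + norm (snd z)) powr \<sigma>2 * cmod (f (fst z) (snd z)))"

definition sup_norm :: "('a \<Rightarrow> 'b \<Rightarrow> complex) \<Rightarrow> real" where
  "sup_norm f = (SUP z. cmod (f (fst z) (snd z)))"

text \<open>sup_{x2} diam(supp f(.,x2)) and sup_{x1} diam(supp f(x1,.)); 0 for f = 0.\<close>
definition diam1 :: "('a::metric_space \<Rightarrow> 'b \<Rightarrow> complex) \<Rightarrow> real" where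
  "diam1 f = Sup ({dist x1 y1 | x1 y1 x2. f x1 x2 \<noteq> 0 \<and> f y1 x2 \<noteq> 0} \<union> {0})"

definition diam2 :: "('a \<Rightarrow> 'b::metric_space \<Rightarrow> complex) \<Rightarrow> real" where
  "diam2 f = Sup ({dist x2 y2 | x2 y2 x1. f x1 x2 \<noteq> 0 \<and> f x1 y2 \<noteq> 0} \<union> {0})"

definition q_quasi_banach :: "real \<Rightarrow> (complex \<Rightarrow> 'v::ab_group_add \<Rightarrow> 'v) \<Rightarrow> ('v \<Rightarrow> real) \<Rightarrow> bool" where
  "q_quasi_banach q sc N \<longleftrightarrow>
     vector_space sc \<and> 0 < q \<and> q \<le> 1 \<and>
     (\<forall>x. 0 \<le> N x) \<and> (\<forall>x. N x = 0 \<longleftrightarrow> x = 0) \<and>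
     (\<forall>c x. N (sc c x) = cmod c * N x) \<and>
     (\<forall>x y. N (x + y) powr q \<le> N x powr q + N y powr q) \<and>
     (\<forall>X. (\<forall>e>0. \<exists>M. \<forall>m\<ge>M. \<forall>n\<ge>M. N (X m - X n) < e) \<longrightarrow>
          (\<exists>L. (\<lambda>n. N (X n - L)) \<longlonglongrightarrow> 0))"

definition Bq_sublinear :: "real \<Rightarrow> ('v::ab_group_add \<Rightarrow> real) \<Rightarrow> (('a \<Rightarrow> 'b \<Rightarrow> complex) \<Rightarrow> 'v) \<Rightarrow>
    ('a \<Rightarrow> 'b \<Rightarrow> complex) set \<Rightarrow> bool" where
  "Bq_sublinear q N T Y \<longleftrightarrow>
     (\<forall>f\<in>Y. \<forall>g\<in>Y. \<forall>l v::complex.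
        N (T (\<lambda>x y. l * f x y + v * g x y))
          \<le> (cmod l powr q * N (T f) powr q + cmod v powr q * N (T g) powr q) powr (1 / q)
      \<and> N (T f - T g) \<le> N (T (\<lambda>x y. f x y - g x y)))"

end

theory Submission
  imports Defs
begin

text \<open>
  In one variable, let \<open>\<theta>\<^sub>i\<close> be a smooth cutoff to the ball of radius \<open>2\<^sup>i\<close> and let
  \<open>\<phi>\<^sub>i\<^sub>,\<^sub>\<alpha>\<close> be bumps at scale \<open>2\<^sup>i\<close> that are dual to the monomials of order at most \<open>s\<close>.  Then
  \<open>P\<^sub>i h = \<theta>\<^sub>i h - (\<Sum>\<alpha>. moment\<^sub>\<alpha> (\<theta>\<^sub>i h) \<phi>\<^sub>i\<^sub>,\<^sub>\<alpha>)\<close> has vanishing moments and equals \<open>h\<close> for large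
  \<open>i\<close>, so that \<open>h\<close> is the telescoping sum of the blocks \<open>P\<^sub>i h - P\<^sub>i\<^sub>-\<^sub>1 h\<close>.  As the moments of \<open>h\<close>
  vanish, those of \<open>\<theta>\<^sub>i h\<close> are minus tail moments, and decay of \<open>h\<close> of order \<open>\<sigma> > n + s\<close> bounds the
  \<open>i\<close>-th block by a multiple of \<open>2\<close> to the power \<open>- i \<sigma>\<close>.  Doing this in both variables
  decomposes \<open>f\<close> into pieces to which the hypothesis on \<open>T\<close> applies, and since \<open>\<sigma> > n / p\<close> the
  \<open>q\<close>-th powers of the resulting bounds form a convergent double geometric series.
\<close>

subsection \<open>Smooth functions\<close>

lemma Ck_Suc_imp_Ck: "Ck (Suc k) g \<Longrightarrow> Ck k g"
proof (induction k arbitrary: g)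
  case 0
  then show ?case
    by (auto intro!: continuous_at_imp_continuous_on dest: has_derivative_continuous)
next
  case (Suc k)
  then show ?case by (metis Ck.simps(2))
qed

lemma Ck_imp_continuous_on: "Ck k g \<Longrightarrow> continuous_on UNIV g"
  by (induction k) (auto dest: Ck_Suc_imp_Ck simp del: Ck.simps(2))

lemma Ck_const: "Ck k (\<lambda>x. c)"
proof (induction k arbitrary: c)
  case (Suc k)
  show ?case by (auto intro!: exI[of _ "\<lambda>x v. 0"] Suc)
qed simp

lemma Ck_add: "Ck k f \<Longrightarrow> Ck k g \<Longrightarrow> Ck k (\<lambda>x. f x + g x)"
proof (induction k arbitrary: f g)
  case (Suc k)
  obtain f' g' where f': "\<And>x. (f has_derivative f' x) (at x)" "\<And>v. Ck k (\<lambda>x. f' x v)"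
    and g': "\<And>x. (g has_derivative g' x) (at x)" "\<And>v. Ck k (\<lambda>x. g' x v)"
    using Suc.prems by auto
  show ?case
    by (auto intro!: exI[of _ "\<lambda>x v. f' x v + g' x v"] Suc.IH f' g' derivative_intros)
qed (simp add: continuous_on_add)

lemma Ck_mult: "Ck k f \<Longrightarrow> Ck k g \<Longrightarrow> Ck k (\<lambda>x. f x * g x)"
proof (induction k arbitrary: f g)
  case (Suc k)
  obtain f' g' where f': "\<And>x. (f has_derivative f' x) (at x)" "\<And>v. Ck k (\<lambda>x. f' x v)"
    and g': "\<And>x. (g has_derivative g' x) (at x)" "\<And>v. Ck k (\<lambda>x. g' x v)"
    using Suc.prems by auto
  have "Ck k f" "Ck k g" using Suc.prems Ck_Suc_imp_Ck by blast+
  then show ?case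
    by (auto intro!: exI[of _ "\<lambda>x v. f x * g' x v + f' x v * g x"] Suc.IH Ck_add f' g'
        derivative_intros)
qed (simp add: continuous_on_mult)

lemma Ck_diff: "Ck k f \<Longrightarrow> Ck k g \<Longrightarrow> Ck k (\<lambda>x. f x - g x)"
  using Ck_add[of k f "\<lambda>x. -1 * g x"] Ck_mult[OF Ck_const[of k "-1"], of g] by simp

lemma Ck_inverse: "Ck k g \<Longrightarrow> (\<And>x. g x \<noteq> 0) \<Longrightarrow> Ck k (\<lambda>x. inverse (g x))"
proof (induction k arbitrary: g)
  case (Suc k)
  obtain g' where g': "\<And>x. (g has_derivative g' x) (at x)" "\<And>v. Ck k (\<lambda>x. g' x v)"
    using Suc.prems by auto
  have "Ck k (\<lambda>x. inverse (g x))"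
    using Suc.prems Suc.IH Ck_Suc_imp_Ck by blast
  then have "Ck k (\<lambda>x. (-1) * (inverse (g x) * g' x v * inverse (g x)))" for v
    by (intro Ck_mult g' Ck_const)
  moreover have "((\<lambda>x. inverse (g x)) has_derivative
      (\<lambda>v. (-1) * (inverse (g x) * g' x v * inverse (g x)))) (at x)" for x
    using Deriv.has_derivative_inverse[OF Suc.prems(2) g'(1), of x] by simp
  ultimately show ?case
    unfolding Ck.simps(2) by (intro exI conjI allI) assumption+
qed (simp add: continuous_on_inverse)

lemma Ck_compose_affine:
  fixes L :: "'a::euclidean_space \<Rightarrow> 'b::euclidean_space"
  assumes L: "bounded_linear L"
  shows "Ck k g \<Longrightarrow> Ck k (\<lambda>x. g (c + L x))"
proof (induction k arbitrary: g)
  case 0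
  have "continuous_on UNIV L" using L by (simp add: linear_continuous_on)
  with 0 show ?case
    by (auto intro!: continuous_on_compose2[of UNIV g] continuous_intros)
next
  case (Suc k)
  obtain g' where g': "\<And>x. (g has_derivative g' x) (at x)" "\<And>v. Ck k (\<lambda>x. g' x v)"
    using Suc.prems by auto
  have "((\<lambda>x. c + L x) has_derivative L) (at x)" for x
    using has_derivative_add[OF has_derivative_const[of c] bounded_linear_imp_has_derivative[OF L]]
    by simp
  then have "((\<lambda>x. g (c + L x)) has_derivative (\<lambda>v. g' (c + L x) (L v))) (at x)" for x
    using has_derivative_compose g' by blast
  then show ?case
    by (auto intro!: exI[of _ "\<lambda>x v. g' (c + L x) (L v)"] Suc.IH g')
qed

lemma Ck_bounded_linear: "bounded_linear f \<Longrightarrow> Ck k f"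
proof (cases k)
  case (Suc m)
  assume "bounded_linear f"
  then show ?thesis
    unfolding Suc by (auto intro!: exI[of _ "\<lambda>_. f"] bounded_linear_imp_has_derivative Ck_const)
qed (simp add: linear_continuous_on)

lemma Ck_inner_self: "Ck k (\<lambda>x::'a::euclidean_space. complex_of_real (x \<bullet> x))"
proof (cases k)
  case 0
  then show ?thesis by (auto intro!: continuous_intros)
next
  case (Suc m)
  have "((\<lambda>x. complex_of_real (x \<bullet> x)) has_derivative (\<lambda>v. complex_of_real (2 * (x \<bullet> v)))) (at x)"
    for x :: 'a
    by (rule has_derivative_of_real) (auto intro!: derivative_eq_intros simp: inner_commute)
  moreover have "Ck m (\<lambda>x::'a. complex_of_real (2 * (x \<bullet> v)))" for v
    by (intro Ck_bounded_linear bounded_linear_compose[OF bounded_linear_of_real]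
        bounded_linear_const_mult bounded_linear_inner_left)
  ultimately show ?thesis
    unfolding Suc Ck.simps(2) by (intro exI conjI allI) assumption+
qed

lemma smooth_imp_continuous_on: "smooth g \<Longrightarrow> continuous_on UNIV g"
  unfolding smooth_def by (meson Ck_imp_continuous_on)

lemma smooth_const: "smooth (\<lambda>x. c)"
  and smooth_add: "smooth f \<Longrightarrow> smooth g \<Longrightarrow> smooth (\<lambda>x. f x + g x)"
  and smooth_diff: "smooth f \<Longrightarrow> smooth g \<Longrightarrow> smooth (\<lambda>x. f x - g x)"
  and smooth_mult: "smooth f \<Longrightarrow> smooth g \<Longrightarrow> smooth (\<lambda>x. f x * g x)"
  and smooth_inverse: "smooth f \<Longrightarrow> (\<And>x. f x \<noteq> 0) \<Longrightarrow> smooth (\<lambda>x. inverse (f x))"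
  by (simp_all add: smooth_def Ck_const Ck_add Ck_diff Ck_mult Ck_inverse)

lemma smooth_compose_affine: "smooth g \<Longrightarrow> bounded_linear L \<Longrightarrow> smooth (\<lambda>x. g (c + L x))"
  by (simp add: smooth_def Ck_compose_affine)

lemma smooth_compose_linear: "smooth g \<Longrightarrow> bounded_linear L \<Longrightarrow> smooth (\<lambda>x. g (L x))"
  using smooth_compose_affine[of g L 0] by simp

text \<open>The factor \<open>1 / t ^ k\<close> makes the family of these functions closed under differentiation.\<close>

definition flat_exp :: "nat \<Rightarrow> real \<Rightarrow> real" where
  "flat_exp k t = (if t \<le> 0 then 0 else exp (- 1 / t) / t ^ k)"

lemma flat_exp_pos: "0 < t \<Longrightarrow> 0 < flat_exp k t"
  and flat_exp_nonneg: "0 \<le> flat_exp k t"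
  and flat_exp_eq_0 [simp]: "t \<le> 0 \<Longrightarrow> flat_exp k t = 0"
  by (auto simp: flat_exp_def)

lemma flat_exp_tendsto_0: "(flat_exp k \<longlongrightarrow> 0) (at 0)"
proof -
  have "(flat_exp k \<longlongrightarrow> 0) (at_right 0)"
  proof (rule Lim_transform_eventually)
    show "((\<lambda>t. inverse t ^ k / exp (inverse t)) \<longlongrightarrow> 0) (at_right (0::real))"
      by (rule filterlim_compose[OF tendsto_power_div_exp_0 filterlim_inverse_at_top_right])
    show "\<forall>\<^sub>F t in at_right 0. inverse t ^ k / exp (inverse t) = flat_exp k t"
      by (auto simp: eventually_at_filter flat_exp_def field_simps exp_minus)
  qed
  moreover have "(flat_exp k \<longlongrightarrow> 0) (at_left 0)"
    by (rule tendsto_eventually) (auto simp: eventually_at_filter)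
  ultimately show ?thesis by (rule filterlim_split_at[rotated])
qed

lemma flat_exp_has_derivative_pos:
  assumes "0 < t"
  shows "(flat_exp k has_real_derivative flat_exp (k + 2) t - real k * flat_exp (k + 1) t) (at t)"
proof -
  let ?d = "(exp (- 1 / t) * (1 / t\<^sup>2) * t ^ k - exp (- 1 / t) * (real k * t ^ (k - 1))) / (t ^ k * t ^ k)"
  have "((\<lambda>t. exp (- 1 / t) / t ^ k) has_real_derivative ?d) (at t)"
    using assms by (auto intro!: derivative_eq_intros simp: power2_eq_square)
  moreover have "?d = flat_exp (k + 2) t - real k * flat_exp (k + 1) t"
    using assms by (cases k) (simp_all add: flat_exp_def field_simps power2_eq_square)
  ultimately have "((\<lambda>t. exp (- 1 / t) / t ^ k) has_real_derivative
      flat_exp (k + 2) t - real k * flat_exp (k + 1) t) (at t)"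
    by simp
  then show ?thesis
    by (rule DERIV_cong_ev[THEN iffD1, rotated -1])
       (use assms eventually_nhds_in_open[of "{0<..}" t] in
        \<open>auto simp: flat_exp_def elim!: eventually_mono\<close>)
qed

lemma flat_exp_has_derivative:
  "(flat_exp k has_real_derivative flat_exp (k + 2) t - real k * flat_exp (k + 1) t) (at t)"
proof (cases t "0::real" rule: linorder_cases)
  case less
  have "((\<lambda>_. 0) has_real_derivative 0) (at t)" by simp
  then have "(flat_exp k has_real_derivative 0) (at t)"
    by (rule DERIV_cong_ev[THEN iffD1, rotated -1])
       (use less eventually_nhds_in_open[of "{..<0}" t] in \<open>auto elim!: eventually_mono\<close>)
  with less show ?thesis by simp
next
  case equal
  have "((\<lambda>h. (flat_exp k h - flat_exp k 0) / h) \<longlongrightarrow> 0) (at 0)"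
    using flat_exp_tendsto_0[of "k + 1"]
    by (rule Lim_transform_eventually) (auto simp: flat_exp_def eventually_at_filter)
  then show ?thesis using equal by (simp add: DERIV_def)
next
  case greater
  then show ?thesis by (rule flat_exp_has_derivative_pos)
qed

lemma Ck_flat_exp:
  "Ck k (\<lambda>x. complex_of_real (u x)) \<Longrightarrow> Ck k (\<lambda>x. complex_of_real (flat_exp m (u x)))"
proof (induction k arbitrary: m)
  case 0
  have "isCont (flat_exp m) t" for t by (rule DERIV_isCont) (rule flat_exp_has_derivative)
  then have "continuous_on UNIV (flat_exp m)" by (simp add: continuous_at_imp_continuous_on)
  moreover have "continuous_on UNIV u"
    using 0 by (simp add: continuous_on_of_real_o_iff[unfolded comp_def])
  ultimately show ?case
    by (auto intro!: continuous_intros continuous_on_compose2[of UNIV "flat_exp m"])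
next
  case (Suc k)
  let ?d = "\<lambda>x. flat_exp (m + 2) (u x) - real m * flat_exp (m + 1) (u x)"
  obtain u' where u': "\<And>x. ((\<lambda>x. complex_of_real (u x)) has_derivative u' x) (at x)"
      "\<And>v. Ck k (\<lambda>x. u' x v)"
    using Suc.prems by auto
  have Re_u': "(u has_derivative (\<lambda>v. Re (u' x v))) (at x)" for x
    using bounded_linear.has_derivative[OF bounded_linear_Re u'(1)] by simp
  have u'_real: "complex_of_real (Re (u' x v)) = u' x v" for x v
    using has_derivative_unique[OF has_derivative_of_real[OF Re_u'] u'(1)] by metis
  have "((\<lambda>x. flat_exp m (u x)) has_derivative (\<lambda>v. ?d x * Re (u' x v))) (at x)" for x
    by (rule has_derivative_compose[OF Re_u'
          flat_exp_has_derivative[unfolded has_field_derivative_def]])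
  then have "((\<lambda>x. complex_of_real (flat_exp m (u x))) has_derivative
      (\<lambda>v. complex_of_real (?d x * Re (u' x v)))) (at x)" for x
    by (rule has_derivative_of_real)
  then have "((\<lambda>x. complex_of_real (flat_exp m (u x))) has_derivative
      (\<lambda>v. complex_of_real (?d x) * u' x v)) (at x)" for x
    by (simp only: of_real_mult u'_real)
  moreover have "Ck k (\<lambda>x. complex_of_real (?d x) * u' x v)" for v
    unfolding of_real_diff of_real_mult
    using Suc.IH[OF Ck_Suc_imp_Ck[OF Suc.prems]] by (intro Ck_mult Ck_diff Ck_const u'(2))
  ultimately show ?case
    unfolding Ck.simps(2) by (intro exI conjI allI) assumption+
qed

lemma smooth_flat_exp:
  "smooth (\<lambda>x. complex_of_real (u x)) \<Longrightarrow> smooth (\<lambda>x. complex_of_real (flat_exp m (u x)))"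
  by (simp add: smooth_def Ck_flat_exp)

definition plateau :: "'a::euclidean_space \<Rightarrow> real" where
  "plateau x = flat_exp 0 (4 - x \<bullet> x) / (flat_exp 0 (4 - x \<bullet> x) + flat_exp 0 (x \<bullet> x - 1))"

lemma plateau_denominator_pos: "0 < flat_exp 0 (4 - x \<bullet> x) + flat_exp 0 (x \<bullet> x - 1)"
  by (cases "x \<bullet> x < 4") (simp_all add: flat_exp_pos flat_exp_nonneg add_pos_nonneg add_nonneg_pos)

lemma plateau_nonneg: "0 \<le> plateau x"
  by (simp add: plateau_def flat_exp_nonneg)

lemma plateau_le_1: "plateau x \<le> 1"
  using plateau_denominator_pos[of x] by (simp add: plateau_def flat_exp_nonneg)

lemma plateau_eq_1: "norm x \<le> 1 \<Longrightarrow> plateau x = 1"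
proof -
  assume "norm x \<le> 1"
  then have "x \<bullet> x \<le> 1" by (simp add: dot_square_norm power_le_one)
  then show ?thesis using plateau_denominator_pos[of x] by (simp add: plateau_def)
qed

lemma plateau_eq_0: "2 \<le> norm x \<Longrightarrow> plateau x = 0"
proof -
  assume "2 \<le> norm x"
  then have "2\<^sup>2 \<le> x \<bullet> x" by (simp only: dot_square_norm power_mono)
  then show ?thesis by (simp add: plateau_def)
qed

lemma smooth_plateau: "smooth (\<lambda>x::'a::euclidean_space. complex_of_real (plateau x))"
proof -
  have inner: "smooth (\<lambda>x::'a. complex_of_real (x \<bullet> x))" by (simp add: smooth_def Ck_inner_self)
  have inside: "smooth (\<lambda>x::'a. complex_of_real (flat_exp 0 (4 - x \<bullet> x)))"
    and outside: "smooth (\<lambda>x::'a. complex_of_real (flat_exp 0 (x \<bullet> x - 1)))"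
    by (rule smooth_flat_exp, unfold of_real_diff, intro smooth_diff smooth_const inner)+
  have denominator:
    "complex_of_real (flat_exp 0 (4 - x \<bullet> x)) + complex_of_real (flat_exp 0 (x \<bullet> x - 1)) \<noteq> 0"
    for x :: 'a
    using plateau_denominator_pos[of x] by (metis of_real_add of_real_eq_0_iff less_irrefl)
  show ?thesis
    unfolding plateau_def divide_inverse of_real_mult of_real_inverse of_real_add
    by (intro smooth_mult smooth_inverse smooth_add inside outside denominator)
qed

subsection \<open>Integration of continuous functions of bounded support\<close>

lemma integrable_continuous_bounded_support:
  fixes g :: "'a::euclidean_space \<Rightarrow> 'b::{banach, second_countable_topology}"
  assumes "continuous_on UNIV g" "bounded {x. g x \<noteq> 0}"
  shows "integrable lborel g"
proof -
  obtain r where r: "{x. g x \<noteq> 0} \<subseteq> ball 0 r" using bounded_subset_ballD[OF assms(2)] by blast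
  have "integrable lborel (\<lambda>x. indicator (cball 0 r) x *\<^sub>R g x)"
    by (intro borel_integrable_compact continuous_on_subset[OF assms(1)]) auto
  also have "(\<lambda>x. indicator (cball 0 r) x *\<^sub>R g x) = g"
    using r by (fastforce simp: indicator_def fun_eq_iff)
  finally show ?thesis .
qed

lemma bounded_range_continuous_bounded_support:
  fixes g :: "'a::heine_borel \<Rightarrow> 'b::real_normed_vector"
  assumes "continuous_on UNIV g" "bounded {x. g x \<noteq> 0}"
  shows "bounded (range g)"
proof (rule bounded_subset)
  have "compact (g ` closure {x. g x \<noteq> 0})"
    using assms by (intro compact_continuous_image) (auto intro: continuous_on_subset)
  then show "bounded (insert 0 (g ` closure {x. g x \<noteq> 0}))" by (simp add: compact_imp_bounded)
  show "range g \<subseteq> insert 0 (g ` closure {x. g x \<noteq> 0})"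
    using closure_subset[of "{x. g x \<noteq> 0}"] by auto
qed

lemma integral_pos_continuous_nonneg:
  fixes g :: "'a::euclidean_space \<Rightarrow> real"
  assumes cont: "continuous_on UNIV g" and int: "integrable lborel g"
    and nonneg: "\<And>x. 0 \<le> g x" and pos: "0 < g c"
  shows "0 < (LINT x|lborel. g x)"
proof (rule ccontr)
  assume "\<not> 0 < (LINT x|lborel. g x)"
  then have "(LINT x|lborel. g x) = 0"
    using nonneg by (simp add: integral_nonneg_AE order_antisym not_less)
  then have "AE x in lborel. g x = 0"
    using integral_nonneg_eq_0_iff_AE[OF int] nonneg by simp
  then have "AE x in lebesgue. x \<in> UNIV \<longrightarrow> x \<in> {x. g x = 0}" by (auto intro: AE_completion)
  moreover have "closed {x. g x = 0}" using closed_Collect_eq[OF cont, of "\<lambda>_. 0"] by simp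
  ultimately have "g c = 0"
    using mem_closed_if_AE_lebesgue_open[of UNIV "{x. g x = 0}" c] by simp
  with pos show False by simp
qed

lemma Ck_parametric_integral_cbox:
  fixes w :: "'a::euclidean_space \<Rightarrow> complex" and G :: "'a \<times> 'b::euclidean_space \<Rightarrow> complex"
  assumes w: "continuous_on UNIV w"
  shows "Ck k G \<Longrightarrow> Ck k (\<lambda>y. integral (cbox a b) (\<lambda>x. G (x, y) * w x))"
proof (induction k arbitrary: G)
  case 0
  then show ?case
    by (auto simp: case_prod_unfold intro!: integral_continuous_on_param continuous_intros
        continuous_on_compose2[OF w] continuous_on_compose2[of UNIV G])
next
  case (Suc k)
  obtain G' where G': "\<And>z. (G has_derivative G' z) (at z)" "\<And>v. Ck k (\<lambda>z. G' z v)"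
    using Suc.prems by auto
  note G_cont = Ck_imp_continuous_on[OF Suc.prems] and G'_cont = Ck_imp_continuous_on[OF G'(2)]
  define D where "D y x = Blinfun (\<lambda>v. G' (x, y) (0, v) * w x)" for x y
  have der: "((\<lambda>y. G (x, y) * w x) has_derivative (\<lambda>v. G' (x, y) (0, v) * w x)) (at y)" for x y
    by (rule has_derivative_mult_left has_derivative_compose[OF _ G'(1)] derivative_eq_intros refl)+
  have D: "blinfun_apply (D y x) = (\<lambda>v. G' (x, y) (0, v) * w x)" for x y
    unfolding D_def using has_derivative_bounded_linear[OF der]
    by (rule bounded_linear_Blinfun_apply)
  have D_cont: "continuous_on S (\<lambda>(y, x). D y x)" for S
    by (rule continuous_on_blinfun_componentwise)
       (auto simp: case_prod_unfold D intro!: continuous_intros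
        continuous_on_compose2[OF w] continuous_on_compose2[OF G'_cont])
  have D_slice_cont: "continuous_on S (D y)" for S y
    using continuous_on_compose2[OF D_cont[of UNIV], of S "\<lambda>x. (y, x)"]
    by (simp add: continuous_on_Pair)
  have "((\<lambda>y. integral (cbox a b) (\<lambda>x. G (x, y) * w x)) has_derivative
      blinfun_apply (integral (cbox a b) (D y))) (at y within UNIV)" for y
    by (rule leibniz_rule)
       (auto simp: D der intro!: D_cont integrable_continuous continuous_intros
        continuous_on_compose2[OF w] continuous_on_compose2[OF G_cont])
  moreover have "blinfun_apply (integral (cbox a b) (D y)) v
      = integral (cbox a b) (\<lambda>x. G' (x, y) (0, v) * w x)" for y v
    by (subst blinfun_apply_integral) (auto simp: D intro!: integrable_continuous D_slice_cont)
  moreover have "Ck k (\<lambda>y. integral (cbox a b) (\<lambda>x. G' (x, y) (0, v) * w x))" for v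
    using Suc.IH[OF G'(2)[of "(0, v)"]] by simp
  ultimately show ?case
    by (auto intro!: exI[of _ "\<lambda>y. blinfun_apply (integral (cbox a b) (D y))"])
qed

lemma smooth_parametric_integral:
  fixes w :: "'a::euclidean_space \<Rightarrow> complex" and G :: "'a \<times> 'b::euclidean_space \<Rightarrow> complex"
  assumes G: "smooth G" "bounded {z. G z \<noteq> 0}" and w: "continuous_on UNIV w"
  shows "smooth (\<lambda>y. LINT x|lborel. G (x, y) * w x)"
proof -
  have supp: "bounded (fst ` {z. G z \<noteq> 0})" using G(2) by (rule bounded_fst)
  then obtain a b where box: "fst ` {z. G z \<noteq> 0} \<subseteq> cbox a b"
    using bounded_subset_cbox_symmetric by metis
  have "(LINT x|lborel. G (x, y) * w x) = integral (cbox a b) (\<lambda>x. G (x, y) * w x)" for y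
  proof -
    have slice: "{x. G (x, y) * w x \<noteq> 0} \<subseteq> fst ` {z. G z \<noteq> 0}" by force
    have "integrable lborel (\<lambda>x. G (x, y) * w x)"
      by (intro integrable_continuous_bounded_support bounded_subset[OF supp slice] continuous_intros
          w continuous_on_compose2[OF smooth_imp_continuous_on[OF G(1)]]) auto
    then have "(LINT x|lborel. G (x, y) * w x) = integral UNIV (\<lambda>x. G (x, y) * w x)"
      by (rule integral_lborel[symmetric])
    also have "\<dots> = integral UNIV (\<lambda>x. if x \<in> cbox a b then G (x, y) * w x else 0)"
      using box slice by (intro arg_cong[of _ _ "integral UNIV"]) (force simp: fun_eq_iff)
    finally show ?thesis by (simp add: integral_restrict_UNIV)
  qed
  then show ?thesis
    using Ck_parametric_integral_cbox[OF w, of _ G a b] G(1) by (simp add: smooth_def)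
qed

subsection \<open>Test functions and their moments\<close>

definition test_fun :: "('a::euclidean_space \<Rightarrow> complex) \<Rightarrow> bool" where
  "test_fun g \<longleftrightarrow> smooth g \<and> bounded {x. g x \<noteq> 0}"

lemma test_fun_continuous: "test_fun g \<Longrightarrow> continuous_on UNIV g"
  by (simp add: test_fun_def smooth_imp_continuous_on)

lemma test_fun_bounded_support: "test_fun g \<Longrightarrow> bounded {x. g x \<noteq> 0}"
  by (simp add: test_fun_def)

lemma test_fun_mult_smooth:
  assumes "smooth g" "test_fun f"
  shows "test_fun (\<lambda>x. g x * f x)"
  using assms unfolding test_fun_def by (auto intro: smooth_mult elim!: bounded_subset)

lemma test_fun_cmult: "test_fun f \<Longrightarrow> test_fun (\<lambda>x. c * f x)"
  by (rule test_fun_mult_smooth[OF smooth_const])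

lemma test_fun_add:
  assumes "test_fun f" "test_fun g"
  shows "test_fun (\<lambda>x. f x + g x)"
proof -
  have "bounded ({x. f x \<noteq> 0} \<union> {x. g x \<noteq> 0})" using assms by (simp add: test_fun_def)
  then have "bounded {x. f x + g x \<noteq> 0}" by (rule bounded_subset) auto
  then show ?thesis using assms by (simp add: test_fun_def smooth_add)
qed

lemma test_fun_diff: "test_fun f \<Longrightarrow> test_fun g \<Longrightarrow> test_fun (\<lambda>x. f x - g x)"
  using test_fun_add[of f "\<lambda>x. -1 * g x"] test_fun_cmult[of g "-1"] by simp

lemma test_fun_sum: "(\<And>k. k \<in> F \<Longrightarrow> test_fun (g k)) \<Longrightarrow> test_fun (\<lambda>x. \<Sum>k\<in>F. g k x)"
proof (induction F rule: infinite_finite_induct)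
  case (insert k F)
  then show ?case by (simp add: test_fun_add)
qed (simp_all add: test_fun_def smooth_const)

lemma test_fun_compose_affine:
  assumes g: "test_fun g" and L: "bounded_linear L" and L': "bounded_linear L'" "\<And>x. L' (L x) = x"
  shows "test_fun (\<lambda>x. g (c + L x))"
proof -
  interpret L': bounded_linear L' by (rule L')
  have "bounded ((\<lambda>y. L' y - L' c) ` {y. g y \<noteq> 0})"
    using g bounded_translation_minus[OF bounded_linear_image[OF _ L'(1)], of "{y. g y \<noteq> 0}" "L' c"]
    by (simp add: test_fun_def image_image)
  moreover have "{x. g (c + L x) \<noteq> 0} \<subseteq> (\<lambda>y. L' y - L' c) ` {y. g y \<noteq> 0}"
    by (auto simp: L'.add L'(2) intro!: image_eqI[of _ _ "c + L _"])
  ultimately show ?thesis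
    using g by (auto simp: test_fun_def smooth_compose_affine[OF _ L] elim: bounded_subset)
qed

lemmas test_fun_compose_linear = test_fun_compose_affine[where c = 0, simplified]

lemma test_fun_tensor:
  fixes f :: "'a::euclidean_space \<Rightarrow> complex" and g :: "'b::euclidean_space \<Rightarrow> complex"
  assumes "test_fun f" "test_fun g"
  shows "test_fun (\<lambda>z. f (fst z) * g (snd z))"
proof -
  have "bounded ({x. f x \<noteq> 0} \<times> {y. g y \<noteq> 0})"
    using assms by (simp add: test_fun_def bounded_Times)
  then have "bounded {z. f (fst z) * g (snd z) \<noteq> 0}" by (rule bounded_subset) auto
  moreover have "smooth (\<lambda>z. f (fst z) * g (snd z))"
    using assms by (auto simp: test_fun_def intro!: smooth_mult
        smooth_compose_linear[OF _ bounded_linear_fst] smooth_compose_linear[OF _ bounded_linear_snd])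
  ultimately show ?thesis by (simp add: test_fun_def)
qed

definition moment :: "('a::euclidean_space \<Rightarrow> nat) \<Rightarrow> ('a \<Rightarrow> complex) \<Rightarrow> complex" where
  "moment \<alpha> g = (LINT x|lborel. g x * complex_of_real (monom_ml \<alpha> x))"

lemma continuous_on_monom_ml: "continuous_on S (monom_ml \<alpha>)"
  unfolding monom_ml_def by (intro continuous_intros)

lemma abs_monom_ml_le: "\<bar>monom_ml \<alpha> x\<bar> \<le> norm x ^ mi_order \<alpha>"
proof -
  have "\<bar>monom_ml \<alpha> x\<bar> = (\<Prod>i\<in>Basis. \<bar>x \<bullet> i\<bar> ^ \<alpha> i)"
    by (simp add: monom_ml_def abs_prod power_abs)
  also have "\<dots> \<le> (\<Prod>i\<in>Basis. norm x ^ \<alpha> i)"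
    by (intro prod_mono conjI power_mono zero_le_power Basis_le_norm) auto
  also have "\<dots> = norm x ^ mi_order \<alpha>" by (simp add: mi_order_def power_sum)
  finally show ?thesis .
qed

lemma integrable_test_fun_monom_ml:
  assumes "test_fun g"
  shows "integrable lborel (\<lambda>x. g x * complex_of_real (monom_ml \<alpha> x))"
proof (rule integrable_continuous_bounded_support)
  show "continuous_on UNIV (\<lambda>x. g x * complex_of_real (monom_ml \<alpha> x))"
    by (intro continuous_intros test_fun_continuous[OF assms] continuous_on_monom_ml)
  show "bounded {x. g x * complex_of_real (monom_ml \<alpha> x) \<noteq> 0}"
    using assms by (auto simp: test_fun_def elim!: bounded_subset)
qed

lemma moment_cmult: "moment \<alpha> (\<lambda>x. c * g x) = c * moment \<alpha> g"
  by (simp add: moment_def mult.assoc)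

lemma moment_add:
  assumes "test_fun f" "test_fun g"
  shows "moment \<alpha> (\<lambda>x. f x + g x) = moment \<alpha> f + moment \<alpha> g"
  using assms by (simp add: moment_def distrib_right integrable_test_fun_monom_ml)

lemma moment_diff:
  assumes "test_fun f" "test_fun g"
  shows "moment \<alpha> (\<lambda>x. f x - g x) = moment \<alpha> f - moment \<alpha> g"
  using assms by (simp add: moment_def left_diff_distrib integrable_test_fun_monom_ml)

lemma moment_sum:
  assumes "\<And>k. k \<in> F \<Longrightarrow> test_fun (g k)"
  shows "moment \<alpha> (\<lambda>x. \<Sum>k\<in>F. g k x) = (\<Sum>k\<in>F. moment \<alpha> (g k))"
  using assms by (simp add: moment_def sum_distrib_right integrable_test_fun_monom_ml)

lemma norm_moment_le:
  fixes g :: "'a::euclidean_space \<Rightarrow> complex"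
  assumes g: "test_fun g" and bound: "\<And>x. cmod (g x) \<le> M"
    and supp: "\<And>x. r < norm x \<Longrightarrow> g x = 0" and r: "0 \<le> r"
  shows "cmod (moment \<alpha> g) \<le> unit_ball_vol DIM('a) * M * r ^ (mi_order \<alpha> + DIM('a))"
proof -
  let ?C = "M * r ^ mi_order \<alpha>"
  have "0 \<le> M" using bound[of 0] by (rule order_trans[rotated]) simp
  have "cmod (moment \<alpha> g) \<le> (LINT x|lborel. cmod (g x * complex_of_real (monom_ml \<alpha> x)))"
    unfolding moment_def by (rule integral_norm_bound)
  also have "\<dots> \<le> (LINT x|lborel. ?C * indicator (cball (0::'a) r) x)"
  proof (rule Bochner_Integration.integral_mono)
    show "integrable lborel (\<lambda>x. cmod (g x * complex_of_real (monom_ml \<alpha> x)))"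
      by (intro integrable_norm integrable_test_fun_monom_ml g)
    show "integrable lborel (\<lambda>x::'a. ?C * indicator (cball 0 r) x)"
      using emeasure_bounded_finite[of "cball (0::'a) r"]
      by (intro integrable_mult_right integrable_real_indicator) auto
    show "cmod (g x * complex_of_real (monom_ml \<alpha> x)) \<le> ?C * indicator (cball 0 r) x" for x
    proof (cases "norm x \<le> r")
      case True
      then have "\<bar>monom_ml \<alpha> x\<bar> \<le> r ^ mi_order \<alpha>"
        by (intro order_trans[OF abs_monom_ml_le] power_mono) auto
      then show ?thesis
        using True bound[of x] \<open>0 \<le> M\<close> by (simp add: norm_mult mult_mono)
    qed (simp add: supp)
  qed
  also have "\<dots> = unit_ball_vol DIM('a) * M * r ^ (mi_order \<alpha> + DIM('a))"
    using r by (simp add: content_cball power_add)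
  finally show ?thesis .
qed

definition coord_scale :: "('a \<Rightarrow> real) \<Rightarrow> 'a \<Rightarrow> 'a::euclidean_space" where
  "coord_scale c x = (\<Sum>j\<in>Basis. (c j * (x \<bullet> j)) *\<^sub>R j)"

lemma coord_scale_inner: "j \<in> Basis \<Longrightarrow> coord_scale c x \<bullet> j = c j * (x \<bullet> j)"
  by (simp add: coord_scale_def inner_sum_left inner_Basis if_distrib sum.delta cong: if_cong)

lemma bounded_linear_coord_scale: "bounded_linear (coord_scale c)"
  unfolding coord_scale_def by (intro bounded_linear_intros)

lemma coord_scale_const: "coord_scale (\<lambda>_. t) x = t *\<^sub>R x"
  by (rule euclidean_eqI) (simp add: coord_scale_inner)

lemma test_fun_coord_scale:
  assumes "test_fun g" "\<And>j. j \<in> Basis \<Longrightarrow> c j \<noteq> 0"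
  shows "test_fun (\<lambda>x. g (coord_scale c x))"
proof (rule test_fun_compose_linear[OF assms(1) bounded_linear_coord_scale bounded_linear_coord_scale])
  show "coord_scale (\<lambda>j. inverse (c j)) (coord_scale c x) = x" for x
    by (rule euclidean_eqI) (simp add: coord_scale_inner assms(2))
qed

lemma moment_coord_scale:
  assumes g: "test_fun g" and nonzero: "\<And>j. j \<in> Basis \<Longrightarrow> c j \<noteq> 0"
  shows "moment \<alpha> g =
    complex_of_real (\<Prod>j\<in>Basis. \<bar>c j\<bar> * c j ^ \<alpha> j) * moment \<alpha> (\<lambda>x. g (coord_scale c x))"
proof -
  let ?h = "\<lambda>x. g x * complex_of_real (monom_ml \<alpha> x)"
  let ?J = "\<Prod>j\<in>Basis. \<bar>c j\<bar>"
  have [measurable]: "?h \<in> borel_measurable borel"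
    by (intro borel_measurable_continuous_onI continuous_intros test_fun_continuous[OF g]
        continuous_on_monom_ml)
  have [measurable]: "coord_scale c \<in> borel_measurable borel"
    by (intro borel_measurable_continuous_onI linear_continuous_on bounded_linear_coord_scale)
  have monom: "monom_ml \<alpha> (coord_scale c x) = (\<Prod>j\<in>Basis. c j ^ \<alpha> j) * monom_ml \<alpha> x" for x
    by (simp add: monom_ml_def coord_scale_inner power_mult_distrib prod.distrib)
  have lborel: "lborel = density (distr lborel borel (coord_scale c)) (\<lambda>_. ennreal ?J)"
    using lborel_affine_euclidean[of c 0] nonzero unfolding coord_scale_def by force
  have "moment \<alpha> g = (LINT x|density (distr lborel borel (coord_scale c)) (\<lambda>_. ennreal ?J). ?h x)"
    unfolding moment_def lborel[symmetric] ..
  also have "\<dots> = (LINT x|lborel. ?J *\<^sub>R ?h (coord_scale c x))"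
    by (subst integral_density) (auto simp: integral_distr prod_nonneg)
  also have "\<dots> = ?J *\<^sub>R (LINT x|lborel. complex_of_real (\<Prod>j\<in>Basis. c j ^ \<alpha> j) *
      (g (coord_scale c x) * complex_of_real (monom_ml \<alpha> x)))"
    by (simp add: monom mult_ac)
  also have "\<dots> = complex_of_real (?J * (\<Prod>j\<in>Basis. c j ^ \<alpha> j)) * moment \<alpha> (\<lambda>x. g (coord_scale c x))"
    by (simp add: moment_def scaleR_conv_of_real)
  finally show ?thesis by (simp only: prod.distrib)
qed

lemma test_fun_scaleR: "test_fun g \<Longrightarrow> t \<noteq> 0 \<Longrightarrow> test_fun (\<lambda>x. g (x /\<^sub>R t))"
  using test_fun_coord_scale[of g "\<lambda>_. inverse t"] by (simp add: coord_scale_const)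

lemma moment_scaleR:
  fixes g :: "'a::euclidean_space \<Rightarrow> complex"
  assumes "test_fun g" "0 < t"
  shows "moment \<alpha> (\<lambda>x. g (x /\<^sub>R t)) = complex_of_real (t ^ (mi_order \<alpha> + DIM('a))) * moment \<alpha> g"
proof -
  have "(\<Prod>j\<in>(Basis::'a set). \<bar>inverse t\<bar> * inverse t ^ \<alpha> j) = inverse (t ^ (mi_order \<alpha> + DIM('a)))"
    using \<open>0 < t\<close>
    by (simp add: prod.distrib power_inverse power_add mi_order_def power_sum prod_inversef[symmetric])
  then show ?thesis
    using moment_coord_scale[OF assms(1), of "\<lambda>_. inverse t" \<alpha>] \<open>0 < t\<close>
    by (simp add: coord_scale_const)
qed

lemma moment_halve_coordinate:
  assumes g: "test_fun g" and b: "b \<in> Basis"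
  shows "moment \<beta> (\<lambda>x. g (coord_scale (\<lambda>j. if j = b then 1 / 2 else 1) x)) =
    2 ^ Suc (\<beta> b) * moment \<beta> g"
proof -
  let ?c = "\<lambda>j. if j = b then 1 / 2 else 1 :: real"
  have "(\<Prod>j\<in>Basis. \<bar>?c j\<bar> * ?c j ^ \<beta> j) = (\<Prod>j\<in>Basis. if j = b then (1 / 2) ^ Suc (\<beta> b) else 1)"
    by (rule prod.cong) auto
  also have "\<dots> = (1 / 2) ^ Suc (\<beta> b)" using b by (simp add: prod.delta)
  finally show ?thesis
    using moment_coord_scale[OF g, of ?c \<beta>] by (simp add: power_one_over)
qed

subsection \<open>Test functions dual to the monomials\<close>

definition multi_indices :: "nat \<Rightarrow> ('a::euclidean_space \<Rightarrow> nat) set" where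
  "multi_indices s = {\<alpha>. (\<forall>b. b \<notin> Basis \<longrightarrow> \<alpha> b = 0) \<and> mi_order \<alpha> \<le> s}"

lemma multi_index_le:
  assumes "\<alpha> \<in> multi_indices s"
  shows "\<alpha> b \<le> s"
proof (cases "b \<in> Basis")
  case True
  then have "\<alpha> b \<le> mi_order \<alpha>" unfolding mi_order_def by (rule member_le_sum) auto
  with assms show ?thesis by (simp add: multi_indices_def)
qed (use assms in \<open>simp add: multi_indices_def\<close>)

lemma finite_multi_indices: "finite (multi_indices s)"
proof (rule finite_subset)
  show "multi_indices s \<subseteq> {\<alpha>. \<forall>b. (b \<in> Basis \<longrightarrow> \<alpha> b \<in> {..s}) \<and> (b \<notin> Basis \<longrightarrow> \<alpha> b = 0)}"
    by (intro subsetI CollectI allI) (auto intro: multi_index_le, simp add: multi_indices_def)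
  show "finite {\<alpha>. \<forall>b::'a. (b \<in> Basis \<longrightarrow> \<alpha> b \<in> {..s}) \<and> (b \<notin> Basis \<longrightarrow> \<alpha> b = 0)}"
    by (rule finite_set_of_finite_funs) auto
qed

definition vanishing_moments :: "nat \<Rightarrow> ('a::euclidean_space \<Rightarrow> complex) \<Rightarrow> bool" where
  "vanishing_moments s g \<longleftrightarrow> (\<forall>\<alpha>. mi_order \<alpha> \<le> s \<longrightarrow> moment \<alpha> g = 0)"

lemma vanishing_moments_iff: "vanishing_moments s g \<longleftrightarrow> (\<forall>\<alpha>\<in>multi_indices s. moment \<alpha> g = 0)"
proof
  assume zero: "\<forall>\<alpha>\<in>multi_indices s. moment \<alpha> g = 0"
  show "vanishing_moments s g"
    unfolding vanishing_moments_def
  proof (intro allI impI)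
    fix \<beta> :: "'a \<Rightarrow> nat" assume \<beta>: "mi_order \<beta> \<le> s"
    let ?\<alpha> = "\<lambda>b. if b \<in> Basis then \<beta> b else 0"
    have "moment ?\<alpha> g = moment \<beta> g" by (simp add: moment_def monom_ml_def)
    moreover have "?\<alpha> \<in> multi_indices s" using \<beta> by (simp add: multi_indices_def mi_order_def)
    ultimately show "moment \<beta> g = 0" using zero by metis
  qed
qed (simp add: vanishing_moments_def multi_indices_def)

lemma vanishing_moments_diff:
  assumes "test_fun f" "test_fun g" "vanishing_moments s f" "vanishing_moments s g"
  shows "vanishing_moments s (\<lambda>x. f x - g x)"
  using assms by (simp add: vanishing_moments_def moment_diff)

lemma vanishing_moments_add:
  assumes "test_fun f" "test_fun g" "vanishing_moments s f" "vanishing_moments s g"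
  shows "vanishing_moments s (\<lambda>x. f x + g x)"
  using assms by (simp add: vanishing_moments_def moment_add)

lemma test_fun_plateau: "test_fun (\<lambda>x::'a::euclidean_space. complex_of_real (plateau x))"
proof -
  have "{x::'a. plateau x \<noteq> 0} \<subseteq> ball 0 2" by (auto simp: not_le[symmetric] plateau_eq_0)
  then have "bounded {x::'a. plateau x \<noteq> 0}" by (rule bounded_subset[OF bounded_ball])
  then show ?thesis using smooth_plateau by (simp add: test_fun_def)
qed

lemma exists_test_fun_nonzero_moments:
  "\<exists>\<eta> :: 'a::euclidean_space \<Rightarrow> complex. test_fun \<eta> \<and> (\<forall>\<alpha>. moment \<alpha> \<eta> \<noteq> 0)"
proof (intro exI[of _ "\<lambda>x. complex_of_real (plateau (- (3 *\<^sub>R One) + x))"] conjI allI)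
  let ?c = "3 *\<^sub>R One :: 'a"
  let ?g = "\<lambda>x. plateau (- ?c + x)"
  show test: "test_fun (\<lambda>x. complex_of_real (?g x))"
    by (rule test_fun_compose_affine[OF test_fun_plateau]) (auto simp: bounded_linear_ident)
  fix \<alpha> :: "'a \<Rightarrow> nat"
  have moment: "moment \<alpha> (\<lambda>x. complex_of_real (?g x)) =
      complex_of_real (LINT x|lborel. ?g x * monom_ml \<alpha> x)"
    by (simp add: moment_def flip: integral_complex_of_real)
  have "0 < (LINT x|lborel. ?g x * monom_ml \<alpha> x)"
  proof (rule integral_pos_continuous_nonneg)
    have "continuous_on UNIV (\<lambda>x. Re (complex_of_real (?g x)) * monom_ml \<alpha> x)"
      by (intro continuous_intros test_fun_continuous[OF test] continuous_on_monom_ml)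
    then show "continuous_on UNIV (\<lambda>x. ?g x * monom_ml \<alpha> x)" by simp
    show "integrable lborel (\<lambda>x. ?g x * monom_ml \<alpha> x)"
      using integrable_test_fun_monom_ml[OF test, of \<alpha>]
      by (simp only: complex_of_real_integrable_eq flip: of_real_mult)
    show "0 \<le> ?g x * monom_ml \<alpha> x" for x
    proof (cases "2 \<le> norm (- ?c + x)")
      case False
      have "0 \<le> x \<bullet> b" if "b \<in> Basis" for b
        using Basis_le_norm[OF that, of "- ?c + x"] False that by (simp add: inner_diff_left abs_le_iff)
      then have "0 \<le> monom_ml \<alpha> x" unfolding monom_ml_def by (intro prod_nonneg zero_le_power)
      then show ?thesis by (simp add: plateau_nonneg)
    qed (simp add: plateau_eq_0)
    show "0 < ?g ?c * monom_ml \<alpha> ?c"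
      by (simp add: plateau_eq_1 monom_ml_def prod_pos)
  qed
  then show "moment \<alpha> (\<lambda>x. complex_of_real (?g x)) \<noteq> 0" unfolding moment by simp
qed

text \<open>
  Halving the \<open>b\<close>-th coordinate multiplies the \<open>\<beta>\<close>-moment by \<open>2 ^ (\<beta> b + 1)\<close>, so that each factor
  of the product arises from one difference of test functions.
\<close>

lemma exists_test_fun_moment_prod:
  assumes \<eta>: "test_fun \<eta>" and "finite F" "F \<subseteq> Basis \<times> UNIV"
  shows "\<exists>\<phi>. test_fun \<phi> \<and> (\<forall>\<beta>. moment \<beta> \<phi> = (\<Prod>(b, l)\<in>F. 2 ^ \<beta> b - 2 ^ l) * moment \<beta> \<eta>)"
  using assms(2,3)
proof (induction F rule: finite_induct)
  case empty
  with \<eta> show ?case by auto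
next
  case (insert x F)
  obtain b l where x: "x = (b, l)" by (cases x)
  with insert.prems have b: "b \<in> Basis" by simp
  from insert obtain \<phi> where \<phi>: "test_fun \<phi>"
    "\<And>\<beta>. moment \<beta> \<phi> = (\<Prod>(b, l)\<in>F. 2 ^ \<beta> b - 2 ^ l) * moment \<beta> \<eta>"
    by auto
  define halved where "halved x = 1 / 2 * \<phi> (coord_scale (\<lambda>j. if j = b then 1 / 2 else 1) x)" for x
  have halved: "test_fun halved"
    unfolding halved_def by (intro test_fun_cmult test_fun_coord_scale \<phi>(1)) auto
  have "moment \<beta> halved = 2 ^ \<beta> b * moment \<beta> \<phi>" for \<beta>
    unfolding halved_def moment_cmult moment_halve_coordinate[OF \<phi>(1) b] by simp
  then have "moment \<beta> (\<lambda>x. halved x - 2 ^ l * \<phi> x) = (2 ^ \<beta> b - 2 ^ l) * moment \<beta> \<phi>" for \<beta>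
    by (simp add: moment_diff halved test_fun_cmult \<phi>(1) moment_cmult left_diff_distrib)
  then show ?case
    using insert.hyps halved \<phi> x
    by (intro exI[of _ "\<lambda>x. halved x - 2 ^ l * \<phi> x"]) (simp add: test_fun_diff test_fun_cmult)
qed

lemma prod_two_power_diff_eq_0_iff:
  assumes "finite F"
  shows "(\<Prod>(b, l)\<in>F. 2 ^ \<beta> b - 2 ^ l) = (0::complex) \<longleftrightarrow> (\<exists>b. (b, \<beta> b) \<in> F)"
proof -
  have "(2::complex) ^ k = of_nat (2 ^ k)" for k by simp
  then have "(2::complex) ^ k = 2 ^ l \<longleftrightarrow> k = l" for k l :: nat
    by (simp only: of_nat_eq_iff) simp
  then show ?thesis
    using assms by (auto simp: case_prod_unfold intro!: bexI[of _ "(_, \<beta> _)"])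
qed

lemma exists_dual_test_fun:
  fixes \<alpha> :: "'a::euclidean_space \<Rightarrow> nat"
  assumes \<alpha>: "\<alpha> \<in> multi_indices s"
  shows "\<exists>\<phi>. test_fun \<phi> \<and> (\<forall>\<beta>\<in>multi_indices s. moment \<beta> \<phi> = (if \<beta> = \<alpha> then 1 else 0))"
proof -
  define F where "F = {(b, l). b \<in> (Basis :: 'a set) \<and> l \<in> {..s} \<and> l \<noteq> \<alpha> b}"
  have "finite F" by (rule finite_subset[of _ "Basis \<times> {..s}"]) (auto simp: F_def)
  moreover have "F \<subseteq> Basis \<times> UNIV" by (auto simp: F_def)
  moreover obtain \<eta> :: "'a \<Rightarrow> complex" where \<eta>: "test_fun \<eta>" "\<And>\<alpha>. moment \<alpha> \<eta> \<noteq> 0"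
    using exists_test_fun_nonzero_moments by blast
  ultimately obtain \<phi> where \<phi>: "test_fun \<phi>"
    "\<And>\<beta>. moment \<beta> \<phi> = (\<Prod>(b, l)\<in>F. 2 ^ \<beta> b - 2 ^ l) * moment \<beta> \<eta>"
    using exists_test_fun_moment_prod by blast
  have zero_iff: "moment \<beta> \<phi> = 0 \<longleftrightarrow> (\<exists>b. (b, \<beta> b) \<in> F)" for \<beta>
    using prod_two_power_diff_eq_0_iff[OF \<open>finite F\<close>] by (simp add: \<phi>(2) \<eta>(2))
  then have "moment \<alpha> \<phi> \<noteq> 0" by (simp add: F_def)
  moreover have "moment \<beta> \<phi> = 0" if \<beta>: "\<beta> \<in> multi_indices s" "\<beta> \<noteq> \<alpha>" for \<beta>
  proof -
    obtain b where "\<beta> b \<noteq> \<alpha> b" using \<beta>(2) by blast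
    then have "(b, \<beta> b) \<in> F"
      using \<alpha> \<beta>(1) multi_index_le[OF \<beta>(1), of b] unfolding F_def multi_indices_def by force
    then show ?thesis using zero_iff by blast
  qed
  ultimately show ?thesis
    using \<phi>(1) by (intro exI[of _ "\<lambda>x. inverse (moment \<alpha> \<phi>) * \<phi> x"])
      (auto simp: test_fun_cmult moment_cmult)
qed

definition dual_bump :: "nat \<Rightarrow> ('a::euclidean_space \<Rightarrow> nat) \<Rightarrow> 'a \<Rightarrow> complex" where
  "dual_bump s \<alpha> =
    (SOME \<phi>. test_fun \<phi> \<and> (\<forall>\<beta>\<in>multi_indices s. moment \<beta> \<phi> = (if \<beta> = \<alpha> then 1 else 0)))"

lemma
  assumes "\<alpha> \<in> multi_indices s"
  shows test_fun_dual_bump: "test_fun (dual_bump s \<alpha>)"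
    and moment_dual_bump: "\<beta> \<in> multi_indices s \<Longrightarrow>
      moment \<beta> (dual_bump s \<alpha>) = (if \<beta> = \<alpha> then 1 else 0)"
  using someI_ex[OF exists_dual_test_fun[OF assms]] by (simp_all add: dual_bump_def)

lemma dual_bump_support:
  obtains R where "0 < R"
    "\<And>(\<alpha>::'a::euclidean_space \<Rightarrow> nat) x. \<alpha> \<in> multi_indices s \<Longrightarrow> R < norm x \<Longrightarrow> dual_bump s \<alpha> x = 0"
proof -
  have "bounded (\<Union>\<alpha>\<in>multi_indices s. {x::'a. dual_bump s \<alpha> x \<noteq> 0})"
    by (intro bounded_UN finite_multi_indices ballI test_fun_bounded_support test_fun_dual_bump)
  then obtain R where "0 < R" "\<forall>x\<in>(\<Union>\<alpha>\<in>multi_indices s. {x::'a. dual_bump s \<alpha> x \<noteq> 0}). norm x \<le> R"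
    unfolding bounded_pos by blast
  then show thesis by (intro that[of R]) force+
qed

lemma dual_bump_bounded:
  obtains B where "0 < B"
    "\<And>(\<alpha>::'a::euclidean_space \<Rightarrow> nat) x. \<alpha> \<in> multi_indices s \<Longrightarrow> cmod (dual_bump s \<alpha> x) \<le> B"
proof -
  have "bounded (\<Union>\<alpha>\<in>multi_indices s. range (dual_bump s (\<alpha>::'a \<Rightarrow> nat)))"
    by (intro bounded_UN finite_multi_indices ballI bounded_range_continuous_bounded_support
        test_fun_continuous test_fun_bounded_support test_fun_dual_bump)
  then show thesis using that unfolding bounded_pos by blast
qed

subsection \<open>Dyadic blocks of a function with vanishing moments\<close>

definition cutoff :: "nat \<Rightarrow> 'a::euclidean_space \<Rightarrow> complex" where
  "cutoff i x = complex_of_real (plateau (x /\<^sub>R 2 ^ i))"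

definition corrector :: "nat \<Rightarrow> nat \<Rightarrow> ('a::euclidean_space \<Rightarrow> nat) \<Rightarrow> 'a \<Rightarrow> complex" where
  "corrector s i \<alpha> x = inverse ((2 ^ i) ^ (mi_order \<alpha> + DIM('a))) * dual_bump s \<alpha> (x /\<^sub>R 2 ^ i)"

definition moment_correction :: "nat \<Rightarrow> nat \<Rightarrow> ('a::euclidean_space \<Rightarrow> complex) \<Rightarrow> 'a \<Rightarrow> complex" where
  "moment_correction s i h x =
    (\<Sum>\<alpha>\<in>multi_indices s. moment \<alpha> (\<lambda>u. cutoff i u * h u) * corrector s i \<alpha> x)"

definition corrected_cutoff :: "nat \<Rightarrow> nat \<Rightarrow> ('a::euclidean_space \<Rightarrow> complex) \<Rightarrow> 'a \<Rightarrow> complex" where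
  "corrected_cutoff s i h x = cutoff i x * h x - moment_correction s i h x"

fun block :: "nat \<Rightarrow> nat \<Rightarrow> ('a::euclidean_space \<Rightarrow> complex) \<Rightarrow> 'a \<Rightarrow> complex" where
  "block s 0 h x = corrected_cutoff s 0 h x"
| "block s (Suc i) h x = corrected_cutoff s (Suc i) h x - corrected_cutoff s i h x"

lemma smooth_cutoff: "smooth (cutoff i)"
  unfolding cutoff_def by (rule smooth_compose_linear[OF smooth_plateau bounded_linear_scaleR_right])

lemma cutoff_eq_1: "norm x \<le> 2 ^ i \<Longrightarrow> cutoff i x = 1"
  by (simp add: cutoff_def plateau_eq_1 field_simps)

lemma cutoff_eq_0: "2 * 2 ^ i \<le> norm x \<Longrightarrow> cutoff i x = 0"
  by (simp add: cutoff_def plateau_eq_0 field_simps)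

lemma norm_cutoff_le_1: "cmod (cutoff i x) \<le> 1"
  by (simp add: cutoff_def plateau_nonneg plateau_le_1)

lemma norm_cutoff_diff_le_1: "cmod (cutoff i x - cutoff j x) \<le> 1"
  using plateau_nonneg plateau_le_1 unfolding cutoff_def of_real_diff[symmetric] norm_of_real
  by (smt (verit))

lemma test_fun_cutoff_mult: "test_fun h \<Longrightarrow> test_fun (\<lambda>x. cutoff i x * h x)"
  by (rule test_fun_mult_smooth[OF smooth_cutoff])

lemma cutoff_mult_eq_self: "(\<And>x. h x \<noteq> 0 \<Longrightarrow> norm x \<le> 2 ^ i) \<Longrightarrow> (\<lambda>x. cutoff i x * h x) = h"
  using cutoff_eq_1 by fastforce

lemma
  fixes \<alpha> :: "'a::euclidean_space \<Rightarrow> nat"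
  assumes \<alpha>: "\<alpha> \<in> multi_indices s"
  shows test_fun_corrector: "test_fun (corrector s i \<alpha>)"
    and moment_corrector: "\<beta> \<in> multi_indices s \<Longrightarrow>
      moment \<beta> (corrector s i \<alpha>) = (if \<beta> = \<alpha> then 1 else 0)"
proof -
  show "test_fun (corrector s i \<alpha>)"
    unfolding corrector_def by (intro test_fun_cmult test_fun_scaleR test_fun_dual_bump \<alpha>) simp
  assume "\<beta> \<in> multi_indices s"
  then show "moment \<beta> (corrector s i \<alpha>) = (if \<beta> = \<alpha> then 1 else 0)"
    using moment_scaleR[OF test_fun_dual_bump[OF \<alpha>], of "2 ^ i" \<beta>] moment_dual_bump[OF \<alpha>]
    by (simp add: corrector_def[abs_def] moment_cmult)
qed

lemma vanishing_moments_corrected_cutoff: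
  assumes h: "test_fun h"
  shows "vanishing_moments s (corrected_cutoff s i h)"
  unfolding vanishing_moments_iff
proof
  fix \<beta> :: "'a \<Rightarrow> nat" assume \<beta>: "\<beta> \<in> multi_indices s"
  let ?m = "\<lambda>\<alpha>. moment \<alpha> (\<lambda>u. cutoff i u * h u)"
  have terms: "test_fun (\<lambda>x. ?m \<alpha> * corrector s i \<alpha> x)" if "\<alpha> \<in> multi_indices s" for \<alpha>
    using that by (intro test_fun_cmult test_fun_corrector)
  then have "test_fun (moment_correction s i h)" unfolding moment_correction_def by (rule test_fun_sum)
  then have "moment \<beta> (corrected_cutoff s i h) = ?m \<beta> - moment \<beta> (moment_correction s i h)"
    unfolding corrected_cutoff_def by (rule moment_diff[OF test_fun_cutoff_mult[OF h]])
  also have "moment \<beta> (moment_correction s i h) =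
      (\<Sum>\<alpha>\<in>multi_indices s. ?m \<alpha> * moment \<beta> (corrector s i \<alpha>))"
    unfolding moment_correction_def by (simp add: moment_sum terms moment_cmult)
  also have "\<dots> = (\<Sum>\<alpha>\<in>multi_indices s. if \<beta> = \<alpha> then ?m \<alpha> else 0)"
    by (rule sum.cong) (simp_all add: moment_corrector \<beta>)
  also have "\<dots> = ?m \<beta>" using \<beta> by (simp add: finite_multi_indices)
  finally show "moment \<beta> (corrected_cutoff s i h) = 0" by simp
qed

lemma corrected_cutoff_eq_self:
  assumes "\<And>x. h x \<noteq> 0 \<Longrightarrow> norm x \<le> 2 ^ i" and "vanishing_moments s h"
  shows "corrected_cutoff s i h = h"
proof -
  have "moment_correction s i h x = 0" for x
    using assms by (simp add: moment_correction_def cutoff_mult_eq_self vanishing_moments_iff)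
  then show ?thesis
    using fun_cong[OF cutoff_mult_eq_self[of h i, OF assms(1)]] by (auto simp: corrected_cutoff_def)
qed

lemma sum_block: "(\<Sum>i\<le>m. block s i h x) = corrected_cutoff s m h x"
  by (induction m) simp_all

lemma sum_block_eq_self:
  assumes "\<And>x. h x \<noteq> 0 \<Longrightarrow> norm x \<le> 2 ^ m" and "vanishing_moments s h"
  shows "(\<Sum>i\<le>m. block s i h x) = h x"
  using corrected_cutoff_eq_self[of h m s, OF assms] by (simp add: sum_block)

lemma corrected_cutoff_zero: "corrected_cutoff s i (\<lambda>_. 0) x = 0"
  by (simp add: corrected_cutoff_def moment_correction_def moment_def)

lemma block_zero: "block s i (\<lambda>_. 0) x = 0"
  by (cases i) (simp_all add: corrected_cutoff_zero)

lemma block_support: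
  obtains R where "0 < R"
    "\<And>(h :: 'a::euclidean_space \<Rightarrow> complex) i x. block s i h x \<noteq> 0 \<Longrightarrow> norm x \<le> R * 2 ^ i"
proof -
  obtain R where "0 < R" and dual_bump_eq_0:
      "\<And>(\<alpha>::'a \<Rightarrow> nat) x. \<alpha> \<in> multi_indices s \<Longrightarrow> R < norm x \<Longrightarrow> dual_bump s \<alpha> x = 0"
    by (rule dual_bump_support) blast
  have corrected: "corrected_cutoff s i h x = 0" if x: "(2 + R) * 2 ^ i < norm x"
    for h :: "'a \<Rightarrow> complex" and i x
  proof -
    have "2 * 2 ^ i \<le> norm x" "R * 2 ^ i < norm x"
      using x \<open>0 < R\<close> by (simp_all add: distrib_right) (smt (verit) mult_pos_pos zero_less_power)+
    then show ?thesis
      by (simp add: corrected_cutoff_def moment_correction_def cutoff_eq_0 corrector_def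
          dual_bump_eq_0 field_simps)
  qed
  have "norm x \<le> (2 + R) * 2 ^ i" if "block s i h x \<noteq> 0" for h :: "'a \<Rightarrow> complex" and i x
  proof (rule ccontr)
    assume "\<not> norm x \<le> (2 + R) * 2 ^ i"
    moreover have "(2 + R) * 2 ^ (i - 1) \<le> (2 + R) * 2 ^ i"
      using \<open>0 < R\<close> by (intro mult_left_mono power_increasing) auto
    ultimately have "block s i h x = 0" by (cases i) (simp_all add: corrected)
    with that show False by contradiction
  qed
  with \<open>0 < R\<close> show thesis by (intro that[of "2 + R"]) auto
qed

subsection \<open>Decay of the dyadic blocks\<close>

lemma sum_geometric_le:
  fixes x :: real
  assumes "finite A" "0 \<le> x" "x < 1"
  shows "(\<Sum>i\<in>A. x ^ i) \<le> 1 / (1 - x)"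
  using sum_le_suminf[of "\<lambda>i. x ^ i" A] assms by (simp add: suminf_geometric)

lemma norm_le_geometric_tail:
  fixes m :: "nat \<Rightarrow> 'a::real_normed_vector"
  assumes step: "\<And>k. norm (m (Suc k) - m k) \<le> c * \<rho> ^ k"
    and \<rho>: "0 \<le> \<rho>" "\<rho> < 1" and lim: "m \<longlonglongrightarrow> 0"
  shows "norm (m i) \<le> c / (1 - \<rho>) * \<rho> ^ i"
proof -
  have "0 \<le> c" using order_trans[OF norm_ge_zero step[of 0]] by simp
  have partial: "norm (m i) \<le> norm (m (n + i)) + c * \<rho> ^ i * (\<Sum>j<n. \<rho> ^ j)" for n
  proof (induction n)
    case (Suc n)
    have "norm (m (n + i)) \<le> norm (m (Suc n + i)) + c * \<rho> ^ (n + i)"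
      using step[of "n + i"] norm_triangle_ineq3[of "m (n + i)" "m (Suc n + i)"]
      by (simp add: norm_minus_commute)
    with Suc show ?case by (simp add: algebra_simps power_add)
  qed simp
  have "norm (m i) \<le> norm (m (n + i)) + c / (1 - \<rho>) * \<rho> ^ i" for n
  proof -
    have "c * \<rho> ^ i * (\<Sum>j<n. \<rho> ^ j) \<le> c * \<rho> ^ i * (1 / (1 - \<rho>))"
      using \<open>0 \<le> c\<close> \<rho> by (intro mult_left_mono sum_geometric_le) auto
    with partial[of n] show ?thesis by simp
  qed
  moreover have "(\<lambda>n. norm (m (n + i)) + c / (1 - \<rho>) * \<rho> ^ i) \<longlonglongrightarrow> 0 + c / (1 - \<rho>) * \<rho> ^ i"
    by (intro tendsto_add tendsto_const tendsto_norm_zero LIMSEQ_ignore_initial_segment lim)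
  ultimately show ?thesis using LIMSEQ_le_const by fastforce
qed

lemma power_powr: "(a ^ n) powr y = (a powr y) ^ n" for a :: real
  by (induction n) (simp_all add: powr_mult)

lemma one_plus_norm_neq_0: "1 + norm x \<noteq> 0"
  using norm_ge_zero[of x] by linarith

definition decay_bound :: "real \<Rightarrow> real \<Rightarrow> ('a::real_normed_vector \<Rightarrow> complex) \<Rightarrow> bool" where
  "decay_bound \<sigma> K h \<longleftrightarrow> (\<forall>x. (1 + norm x) powr \<sigma> * cmod (h x) \<le> K)"

lemma decay_bound_nonneg: "decay_bound \<sigma> K h \<Longrightarrow> 0 \<le> K"
  unfolding decay_bound_def by (meson order_trans mult_nonneg_nonneg norm_ge_zero powr_ge_zero)

lemma decay_bound_norm_le:
  assumes "decay_bound \<sigma> K h" "0 \<le> \<sigma>" "0 < r" "r \<le> 1 + norm x"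
  shows "cmod (h x) \<le> K * r powr (- \<sigma>)"
proof -
  have "r powr \<sigma> * cmod (h x) \<le> (1 + norm x) powr \<sigma> * cmod (h x)"
    using assms by (intro mult_right_mono powr_mono2) auto
  also have "\<dots> \<le> K" using assms(1) by (simp add: decay_bound_def)
  finally show ?thesis using \<open>0 < r\<close> by (simp add: powr_minus field_simps)
qed

lemma norm_cutoff_increment_le:
  assumes h: "decay_bound \<sigma> K h" and "0 \<le> \<sigma>"
  shows "cmod ((cutoff (Suc k) x - cutoff k x) * h x) \<le> K * (2 ^ k) powr (- \<sigma>)"
proof (cases "norm x \<le> 2 ^ k")
  case True
  moreover from True have "norm x \<le> 2 ^ Suc k" by (rule order_trans) simp
  ultimately have "cutoff (Suc k) x - cutoff k x = 0" by (simp only: cutoff_eq_1 diff_self)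
  then show ?thesis using decay_bound_nonneg[OF h] by simp
next
  case False
  have "cmod ((cutoff (Suc k) x - cutoff k x) * h x) \<le> 1 * cmod (h x)"
    unfolding norm_mult by (intro mult_right_mono norm_cutoff_diff_le_1) simp
  also have "cmod (h x) \<le> K * (2 ^ k) powr (- \<sigma>)"
    using False by (intro decay_bound_norm_le[OF h \<open>0 \<le> \<sigma>\<close>]) auto
  finally show ?thesis by simp
qed

lemma norm_moment_cutoff_increment_le:
  fixes h :: "'a::euclidean_space \<Rightarrow> complex" and \<alpha> :: "'a \<Rightarrow> nat"
  assumes h: "test_fun h" "decay_bound \<sigma> K h" and "0 \<le> \<sigma>"
  defines "n \<equiv> mi_order \<alpha> + DIM('a)"
  shows "cmod (moment \<alpha> (\<lambda>u. cutoff (Suc k) u * h u) - moment \<alpha> (\<lambda>u. cutoff k u * h u))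
    \<le> unit_ball_vol DIM('a) * 4 ^ n * K * (2 ^ k) powr (real n - \<sigma>)"
proof -
  let ?g = "\<lambda>u. (cutoff (Suc k) u - cutoff k u) * h u"
  have "moment \<alpha> (\<lambda>u. cutoff (Suc k) u * h u) - moment \<alpha> (\<lambda>u. cutoff k u * h u) = moment \<alpha> ?g"
    using h(1) by (simp add: left_diff_distrib moment_diff test_fun_cutoff_mult)
  also have "cmod \<dots> \<le> unit_ball_vol DIM('a) * (K * (2 ^ k) powr (- \<sigma>)) * (4 * 2 ^ k) ^ n"
    unfolding n_def
  proof (rule norm_moment_le)
    show "test_fun ?g"
      unfolding left_diff_distrib by (intro test_fun_diff test_fun_cutoff_mult h(1))
    show "?g x = 0" if "4 * 2 ^ k < norm x" for x
    proof -
      have "2 * 2 ^ k \<le> norm x" "2 * 2 ^ Suc k \<le> norm x"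
        using that zero_le_power[of "2::real" k] unfolding power_Suc by linarith+
      then show ?thesis by (simp only: cutoff_eq_0 diff_self mult_zero_left)
    qed
  qed (use norm_cutoff_increment_le[OF h(2) \<open>0 \<le> \<sigma>\<close>] in auto)
  also have "\<dots> = unit_ball_vol DIM('a) * 4 ^ n * K * ((2 ^ k) ^ n * (2 ^ k) powr (- \<sigma>))"
    by (simp add: power_mult_distrib)
  also have "(2 ^ k) ^ n * (2 ^ k) powr (- \<sigma>) = (2 ^ k) powr (real n - \<sigma>)"
    by (simp add: powr_diff powr_minus powr_realpow divide_inverse)
  finally show ?thesis .
qed

definition tail_const :: "real \<Rightarrow> ('a::euclidean_space \<Rightarrow> nat) \<Rightarrow> real" where
  "tail_const \<sigma> \<alpha> = unit_ball_vol DIM('a) * 4 ^ (mi_order \<alpha> + DIM('a)) /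
    (1 - 2 powr (real (mi_order \<alpha> + DIM('a)) - \<sigma>))"

lemma tail_const_nonneg:
  fixes \<alpha> :: "'a::euclidean_space \<Rightarrow> nat"
  assumes "real (mi_order \<alpha> + DIM('a)) < \<sigma>"
  shows "0 \<le> tail_const \<sigma> \<alpha>"
  using assms powr_less_one[of 2 "real (mi_order \<alpha> + DIM('a)) - \<sigma>"] by (simp add: tail_const_def)

text \<open>
  Since the full moment of \<open>h\<close> vanishes, the truncated moment is minus the tail of its increments.
\<close>

lemma norm_moment_cutoff_le:
  fixes h :: "'a::euclidean_space \<Rightarrow> complex" and \<alpha> :: "'a \<Rightarrow> nat"
  assumes h: "test_fun h" "decay_bound \<sigma> K h" "moment \<alpha> h = 0"
  defines "n \<equiv> mi_order \<alpha> + DIM('a)"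
  assumes \<sigma>: "real n < \<sigma>"
  shows "cmod (moment \<alpha> (\<lambda>u. cutoff i u * h u))
    \<le> tail_const \<sigma> \<alpha> * K * (2 ^ i) powr (real n - \<sigma>)"
proof -
  let ?m = "\<lambda>k. moment \<alpha> (\<lambda>u. cutoff k u * h u)"
  have "cmod (?m (Suc k) - ?m k) \<le>
      unit_ball_vol DIM('a) * 4 ^ n * K * (2 powr (real n - \<sigma>)) ^ k" for k
    using norm_moment_cutoff_increment_le[OF h(1,2), of \<alpha> k] \<sigma> by (simp add: n_def power_powr)
  moreover have "2 powr (real n - \<sigma>) < 1" using \<sigma> by (intro powr_less_one) auto
  moreover have "?m \<longlonglongrightarrow> 0"
  proof (rule tendsto_eventually)
    obtain r where r: "\<And>x. h x \<noteq> 0 \<Longrightarrow> norm x \<le> r"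
      using test_fun_bounded_support[OF h(1)] unfolding bounded_iff by auto
    obtain j where "r < 2 ^ j" using real_arch_pow[of 2 r] by auto
    show "\<forall>\<^sub>F k in sequentially. ?m k = 0"
    proof (rule eventually_sequentiallyI)
      fix k assume "j \<le> k"
      then have "(2::real) ^ j \<le> 2 ^ k" by simp
      with \<open>r < 2 ^ j\<close> have "r \<le> 2 ^ k" by linarith
      then have "(\<lambda>x. cutoff k x * h x) = h" by (intro cutoff_mult_eq_self order_trans[OF r])
      then show "?m k = 0" by (simp add: h(3))
    qed
  qed
  ultimately have "cmod (?m i) \<le> unit_ball_vol DIM('a) * 4 ^ n * K / (1 - 2 powr (real n - \<sigma>)) *
      (2 powr (real n - \<sigma>)) ^ i"
    by (intro norm_le_geometric_tail) auto
  then show ?thesis by (simp add: power_powr tail_const_def n_def)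
qed

lemma norm_moment_cutoff_mult_corrector_le:
  fixes h :: "'a::euclidean_space \<Rightarrow> complex" and \<alpha> :: "'a \<Rightarrow> nat"
  assumes h: "test_fun h" "decay_bound \<sigma> K h" "moment \<alpha> h = 0"
    and \<sigma>: "real (mi_order \<alpha> + DIM('a)) < \<sigma>" and B: "\<And>x. cmod (dual_bump s \<alpha> x) \<le> B"
  shows "cmod (moment \<alpha> (\<lambda>u. cutoff i u * h u) * corrector s i \<alpha> x)
    \<le> tail_const \<sigma> \<alpha> * B * (K * (2 ^ i) powr (- \<sigma>))"
proof -
  define n where "n = mi_order \<alpha> + DIM('a)"
  have "cmod (moment \<alpha> (\<lambda>u. cutoff i u * h u)) \<le> tail_const \<sigma> \<alpha> * K * (2 ^ i) powr (real n - \<sigma>)"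
    unfolding n_def by (rule norm_moment_cutoff_le[OF h \<sigma>])
  moreover have "cmod (corrector s i \<alpha> x) \<le> inverse ((2 ^ i) ^ n) * B"
    using B by (simp add: corrector_def n_def norm_mult norm_inverse norm_power)
  ultimately have "cmod (moment \<alpha> (\<lambda>u. cutoff i u * h u) * corrector s i \<alpha> x) \<le>
      tail_const \<sigma> \<alpha> * K * (2 ^ i) powr (real n - \<sigma>) * (inverse ((2 ^ i) ^ n) * B)"
    unfolding norm_mult using tail_const_nonneg[OF \<sigma>] decay_bound_nonneg[OF h(2)]
    by (intro mult_mono) auto
  also have "\<dots> = tail_const \<sigma> \<alpha> * B * (K * (2 ^ i) powr (- \<sigma>))"
    by (simp add: powr_diff powr_minus powr_realpow field_simps)
  finally show ?thesis .
qed

lemma norm_moment_correction_le: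
  assumes \<sigma>: "real DIM('a) + real s < \<sigma>"
  obtains E where "0 \<le> E"
    "\<And>(h :: 'a::euclidean_space \<Rightarrow> complex) K i x.
      test_fun h \<Longrightarrow> vanishing_moments s h \<Longrightarrow> decay_bound \<sigma> K h \<Longrightarrow>
      cmod (moment_correction s i h x) \<le> E * K * (2 ^ i) powr (- \<sigma>)"
proof -
  let ?A = "multi_indices s :: ('a \<Rightarrow> nat) set"
  obtain B where "0 < B" and B: "\<And>(\<alpha>::'a \<Rightarrow> nat) x. \<alpha> \<in> ?A \<Longrightarrow> cmod (dual_bump s \<alpha> x) \<le> B"
    by (rule dual_bump_bounded) blast
  have order: "real (mi_order \<alpha> + DIM('a)) < \<sigma>" if "\<alpha> \<in> ?A" for \<alpha>
    using that \<sigma> by (simp add: multi_indices_def)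
  show thesis
  proof (rule that[of "\<Sum>\<alpha>\<in>?A. tail_const \<sigma> \<alpha> * B"])
    show "0 \<le> (\<Sum>\<alpha>\<in>?A. tail_const \<sigma> \<alpha> * B)"
      using tail_const_nonneg order \<open>0 < B\<close> by (intro sum_nonneg mult_nonneg_nonneg) auto
    fix h :: "'a \<Rightarrow> complex" and K i x
    assume h: "test_fun h" "vanishing_moments s h" "decay_bound \<sigma> K h"
    have "cmod (moment_correction s i h x) \<le> (\<Sum>\<alpha>\<in>?A. tail_const \<sigma> \<alpha> * B * (K * (2 ^ i) powr (- \<sigma>)))"
      unfolding moment_correction_def using h(2)
      by (intro sum_norm_le norm_moment_cutoff_mult_corrector_le h(1,3) order B)
         (simp_all add: vanishing_moments_iff)
    then show "cmod (moment_correction s i h x) \<le>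
        (\<Sum>\<alpha>\<in>?A. tail_const \<sigma> \<alpha> * B) * K * (2 ^ i) powr (- \<sigma>)"
      by (simp add: sum_distrib_right mult.assoc)
  qed
qed

lemma norm_block_0_le:
  assumes h: "decay_bound \<sigma> K h" and "0 \<le> \<sigma>"
  shows "cmod (block s 0 h x) \<le> K + cmod (moment_correction s 0 h x)"
proof -
  have "cmod (cutoff 0 x * h x) \<le> 1 * cmod (h x)"
    unfolding norm_mult by (intro mult_right_mono norm_cutoff_le_1) simp
  also have "\<dots> \<le> K" using decay_bound_norm_le[OF h \<open>0 \<le> \<sigma>\<close>, of 1 x] by simp
  finally show ?thesis
    using norm_triangle_ineq4[of "cutoff 0 x * h x" "moment_correction s 0 h x"]
    by (simp add: corrected_cutoff_def)
qed

lemma norm_block_Suc_le: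
  assumes h: "decay_bound \<sigma> K h" and "0 \<le> \<sigma>"
  shows "cmod (block s (Suc k) h x) \<le> K * (2 ^ k) powr (- \<sigma>) +
    cmod (moment_correction s (Suc k) h x) + cmod (moment_correction s k h x)"
proof -
  let ?inc = "(cutoff (Suc k) x - cutoff k x) * h x - moment_correction s (Suc k) h x"
  have "block s (Suc k) h x = ?inc + moment_correction s k h x"
    by (simp add: corrected_cutoff_def algebra_simps)
  then have "cmod (block s (Suc k) h x) \<le> cmod ?inc + cmod (moment_correction s k h x)"
    by (simp only: norm_triangle_ineq)
  also have "cmod ?inc \<le> K * (2 ^ k) powr (- \<sigma>) + cmod (moment_correction s (Suc k) h x)"
    by (rule order_trans[OF norm_triangle_ineq4
          add_right_mono[OF norm_cutoff_increment_le[OF assms]]])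
  finally show ?thesis by simp
qed

lemma norm_block_le:
  assumes \<sigma>: "real DIM('a) + real s < \<sigma>"
  obtains C where "0 < C"
    "\<And>(h :: 'a::euclidean_space \<Rightarrow> complex) K i x.
      test_fun h \<Longrightarrow> vanishing_moments s h \<Longrightarrow> decay_bound \<sigma> K h \<Longrightarrow>
      cmod (block s i h x) \<le> C * K * (2 ^ i) powr (- \<sigma>)"
proof -
  obtain E where "0 \<le> E" and E: "\<And>(h :: 'a \<Rightarrow> complex) K i x.
      test_fun h \<Longrightarrow> vanishing_moments s h \<Longrightarrow> decay_bound \<sigma> K h \<Longrightarrow>
      cmod (moment_correction s i h x) \<le> E * K * (2 ^ i) powr (- \<sigma>)"
    by (rule norm_moment_correction_le[OF \<sigma>]) blast
  have "0 \<le> \<sigma>" using \<sigma> by simp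
  show thesis
  proof (rule that[of "(1 + 2 * E) * 2 powr \<sigma>"])
    show "0 < (1 + 2 * E) * 2 powr \<sigma>" using \<open>0 \<le> E\<close> by simp
    fix h :: "'a \<Rightarrow> complex" and K i x
    assume h: "test_fun h" "vanishing_moments s h" "decay_bound \<sigma> K h"
    have "0 \<le> K" by (rule decay_bound_nonneg[OF h(3)])
    with \<open>0 \<le> E\<close> have "0 \<le> E * K" by simp
    note correction = E[OF h, of _ x]
    show "cmod (block s i h x) \<le> (1 + 2 * E) * 2 powr \<sigma> * K * (2 ^ i) powr (- \<sigma>)"
    proof (cases i)
      case 0
      have "cmod (block s 0 h x) \<le> (1 + 2 * E) * K * 1"
        using norm_block_0_le[OF h(3) \<open>0 \<le> \<sigma>\<close>, of s x] correction[of 0] \<open>0 \<le> E * K\<close>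
        by (simp add: algebra_simps)
      also have "\<dots> \<le> (1 + 2 * E) * K * 2 powr \<sigma>"
        using \<open>0 \<le> K\<close> \<open>0 \<le> E\<close> \<open>0 \<le> \<sigma>\<close> by (intro mult_left_mono ge_one_powr_ge_zero) auto
      finally show ?thesis by (simp add: 0 mult_ac)
    next
      case (Suc k)
      have "E * K * (2 ^ Suc k) powr (- \<sigma>) \<le> E * K * (2 ^ k) powr (- \<sigma>)"
        using \<open>0 \<le> E * K\<close> \<open>0 \<le> \<sigma>\<close> by (intro mult_left_mono powr_mono2') auto
      then have "cmod (block s (Suc k) h x) \<le> (1 + 2 * E) * K * (2 ^ k) powr (- \<sigma>)"
        using norm_block_Suc_le[OF h(3) \<open>0 \<le> \<sigma>\<close>, of s k x] correction[of "Suc k"] correction[of k]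
        by (simp add: algebra_simps)
      also have "(2 ^ k) powr (- \<sigma>) = 2 powr \<sigma> * (2 ^ Suc k) powr (- \<sigma>)"
        by (simp add: powr_mult powr_minus)
      finally show ?thesis by (simp add: Suc mult_ac)
    qed
  qed
qed

subsection \<open>Dyadic pieces of a function of two variables\<close>

lemma Dspace_iff:
  "f \<in> Dspace s1 s2 \<longleftrightarrow> test_fun (\<lambda>z. f (fst z) (snd z)) \<and>
    (\<forall>y. vanishing_moments s1 (\<lambda>x. f x y)) \<and> (\<forall>x. vanishing_moments s2 (f x))"
  unfolding Dspace_def test_fun_def vanishing_moments_def moment_def compact_closure by blast

lemma test_fun_fst_slice:
  assumes "test_fun (\<lambda>z. f (fst z) (snd z))"
  shows "test_fun (\<lambda>x. f x y)"
  using test_fun_compose_affine[OF assms, of "\<lambda>x. (x, 0)" fst "(0, y)"]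
  by (simp add: bounded_linear_Pair bounded_linear_ident bounded_linear_zero bounded_linear_fst)

lemma test_fun_swap:
  assumes "test_fun (\<lambda>z. f (fst z) (snd z))"
  shows "test_fun (\<lambda>z. f (snd z) (fst z))"
  using test_fun_compose_linear[OF assms, of "\<lambda>z. (snd z, fst z)" "\<lambda>z. (snd z, fst z)"]
  by (simp add: bounded_linear_Pair bounded_linear_fst bounded_linear_snd)

lemma test_fun_snd_slice: "test_fun (\<lambda>z. f (fst z) (snd z)) \<Longrightarrow> test_fun (f x)"
  using test_fun_fst_slice[of "\<lambda>y x. f x y" x] test_fun_swap[of f] by simp

lemma test_fun_moment:
  assumes f: "test_fun (\<lambda>z. f (fst z) (snd z))"
  shows "test_fun (\<lambda>y. moment \<alpha> (\<lambda>x. f x y))"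
proof -
  have "smooth (\<lambda>y. moment \<alpha> (\<lambda>x. f x y))"
    using f smooth_parametric_integral[of "\<lambda>z. f (fst z) (snd z)" "\<lambda>x. complex_of_real (monom_ml \<alpha> x)"]
    by (simp add: moment_def test_fun_def continuous_on_of_real continuous_on_monom_ml)
  moreover have "{y. moment \<alpha> (\<lambda>x. f x y) \<noteq> 0} \<subseteq> snd ` {z. f (fst z) (snd z) \<noteq> 0}"
  proof
    fix y assume "y \<in> {y. moment \<alpha> (\<lambda>x. f x y) \<noteq> 0}"
    then obtain x where "f x y \<noteq> 0" by (force simp: moment_def)
    then show "y \<in> snd ` {z. f (fst z) (snd z) \<noteq> 0}" by (intro image_eqI[of _ _ "(x, y)"]) auto
  qed
  ultimately show ?thesis
    using bounded_snd[OF test_fun_bounded_support[OF f]]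
    by (auto simp: test_fun_def elim: bounded_subset)
qed

lemma moment_moment_swap:
  assumes f: "test_fun (\<lambda>z. f (fst z) (snd z))"
  shows "moment \<beta> (\<lambda>y. moment \<alpha> (\<lambda>x. f x y)) = moment \<alpha> (\<lambda>x. moment \<beta> (f x))"
proof -
  let ?F = "\<lambda>x y. f x y * complex_of_real (monom_ml \<alpha> x) * complex_of_real (monom_ml \<beta> y)"
  have "integrable lborel (\<lambda>z. ?F (fst z) (snd z))"
  proof (rule integrable_continuous_bounded_support)
    show "continuous_on UNIV (\<lambda>z. ?F (fst z) (snd z))"
      by (intro continuous_intros test_fun_continuous[OF f]
          continuous_on_compose2[OF continuous_on_monom_ml[of UNIV]]) auto
    show "bounded {z. ?F (fst z) (snd z) \<noteq> 0}"
      using test_fun_bounded_support[OF f] by (rule bounded_subset) auto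
  qed
  then have "integrable (lborel \<Otimes>\<^sub>M lborel) (case_prod ?F)"
    by (simp add: lborel_prod case_prod_unfold)
  then have "(LINT y|lborel. LINT x|lborel. ?F x y) = (LINT x|lborel. LINT y|lborel. ?F x y)"
    by (rule lborel_pair.Fubini_integral)
  also have "\<dots> = moment \<alpha> (\<lambda>x. moment \<beta> (f x))"
    by (simp add: moment_def mult_ac flip: integral_mult_right_zero)
  finally show ?thesis by (simp add: moment_def)
qed

lemma Dspace_swap: "f \<in> Dspace s1 s2 \<Longrightarrow> (\<lambda>y x. f x y) \<in> Dspace s2 s1"
  by (simp add: Dspace_iff test_fun_swap)

lemma Dspace_zero: "(\<lambda>x y. 0) \<in> Dspace s1 s2"
  by (simp add: Dspace_iff test_fun_def smooth_const vanishing_moments_def moment_def)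

lemma Dspace_add: "f \<in> Dspace s1 s2 \<Longrightarrow> g \<in> Dspace s1 s2 \<Longrightarrow> (\<lambda>x y. f x y + g x y) \<in> Dspace s1 s2"
  by (simp add: Dspace_iff test_fun_add vanishing_moments_add test_fun_fst_slice test_fun_snd_slice)

lemma Dspace_diff: "f \<in> Dspace s1 s2 \<Longrightarrow> g \<in> Dspace s1 s2 \<Longrightarrow> (\<lambda>x y. f x y - g x y) \<in> Dspace s1 s2"
  by (simp add: Dspace_iff test_fun_diff vanishing_moments_diff test_fun_fst_slice test_fun_snd_slice)

lemma Dspace_corrected_cutoff:
  fixes f :: "'a::euclidean_space \<Rightarrow> 'b::euclidean_space \<Rightarrow> complex"
  assumes f: "f \<in> Dspace s1 s2"
  shows "(\<lambda>x y. corrected_cutoff s1 i (\<lambda>u. f u y) x) \<in> Dspace s1 s2"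
proof -
  let ?cut = "\<lambda>x y. cutoff i x * f x y"
  let ?m = "\<lambda>\<alpha> y. moment \<alpha> (\<lambda>u. ?cut u y)"
  have test: "test_fun (\<lambda>z. f (fst z) (snd z))" using f by (simp add: Dspace_iff)
  have cut: "test_fun (\<lambda>z. ?cut (fst z) (snd z))"
    by (intro test_fun_mult_smooth test smooth_compose_linear[OF smooth_cutoff bounded_linear_fst])
  have cut_moment: "test_fun (?m \<alpha>)" for \<alpha> by (rule test_fun_moment[OF cut])
  have expand: "corrected_cutoff s1 i (\<lambda>u. f u y) x =
      ?cut x y - (\<Sum>\<alpha>\<in>multi_indices s1. corrector s1 i \<alpha> x * ?m \<alpha> y)" for x y
    by (simp add: corrected_cutoff_def moment_correction_def mult.commute)
  have "test_fun (\<lambda>z. corrected_cutoff s1 i (\<lambda>u. f u (snd z)) (fst z))"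
    unfolding expand
    by (intro test_fun_diff cut test_fun_sum test_fun_tensor test_fun_corrector cut_moment)
  moreover have "vanishing_moments s1 (corrected_cutoff s1 i (\<lambda>u. f u y))" for y
    by (rule vanishing_moments_corrected_cutoff[OF test_fun_fst_slice[OF test]])
  moreover have "moment \<beta> (\<lambda>y. corrected_cutoff s1 i (\<lambda>u. f u y) x) = 0"
    if "mi_order \<beta> \<le> s2" for \<beta> x
  proof -
    have zero: "moment \<beta> (f u) = 0" for u
      using f that by (simp add: Dspace_iff vanishing_moments_def)
    then have "moment \<beta> (?m \<alpha>) = 0" for \<alpha>
      by (simp add: moment_moment_swap[OF cut] moment_cmult) (simp add: moment_def)
    then show ?thesis
      unfolding expand using test_fun_snd_slice[OF cut]
      by (simp add: moment_diff test_fun_sum test_fun_cmult cut_moment moment_sum moment_cmult zero)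
  qed
  ultimately show ?thesis by (simp add: Dspace_iff vanishing_moments_def)
qed

lemma Dspace_block: "f \<in> Dspace s1 s2 \<Longrightarrow> (\<lambda>x y. block s1 i (\<lambda>u. f u y) x) \<in> Dspace s1 s2"
  by (cases i) (simp_all add: Dspace_corrected_cutoff Dspace_diff)

lemma Dspace_block_snd:
  assumes f: "f \<in> Dspace s1 s2"
  shows "(\<lambda>x. block s2 j (f x)) \<in> Dspace s1 s2"
  using Dspace_swap[OF Dspace_block[OF Dspace_swap[OF f], of j]] by simp

definition dyadic_piece ::
    "nat \<Rightarrow> nat \<Rightarrow> ('a::euclidean_space \<Rightarrow> 'b::euclidean_space \<Rightarrow> complex) \<Rightarrow>
      nat \<Rightarrow> nat \<Rightarrow> 'a \<Rightarrow> 'b \<Rightarrow> complex"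
  where "dyadic_piece s1 s2 f i j x y = block s1 i (\<lambda>u. block s2 j (f u) y) x"

lemma Dspace_dyadic_piece: "f \<in> Dspace s1 s2 \<Longrightarrow> dyadic_piece s1 s2 f i j \<in> Dspace s1 s2"
  unfolding dyadic_piece_def[abs_def] by (rule Dspace_block[OF Dspace_block_snd])

lemma eq_sum_dyadic_piece:
  assumes f: "f \<in> Dspace s1 s2"
  obtains m where "f = (\<lambda>x y. \<Sum>(i, j)\<in>{..m} \<times> {..m}. dyadic_piece s1 s2 f i j x y)"
proof -
  have "bounded {z. f (fst z) (snd z) \<noteq> 0}"
    using f by (simp add: Dspace_iff test_fun_bounded_support)
  then obtain r where r: "\<And>x y. f x y \<noteq> 0 \<Longrightarrow> norm (x, y) \<le> r" unfolding bounded_iff by auto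
  obtain m where "r < 2 ^ m" using real_arch_pow[of 2 r] by auto
  then have supp: "norm x \<le> 2 ^ m" "norm y \<le> 2 ^ m" if "f x y \<noteq> 0" for x y
    using r[OF that] norm_fst_le[of x y] norm_snd_le[of y x] by linarith+
  have "(\<Sum>(i, j)\<in>{..m} \<times> {..m}. dyadic_piece s1 s2 f i j x y) = f x y" for x y
  proof -
    have inner: "(\<Sum>i\<le>m. dyadic_piece s1 s2 f i j x y) = block s2 j (f x) y" for j
    proof -
      have "norm u \<le> 2 ^ m" if "block s2 j (f u) y \<noteq> 0" for u
        using that supp(1)[of u] block_zero[of s2 j y] by (metis ext)
      moreover have "vanishing_moments s1 (\<lambda>u. block s2 j (f u) y)"
        using Dspace_block_snd[OF f] by (simp add: Dspace_iff)
      ultimately show ?thesis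
        by (simp add: dyadic_piece_def sum_block_eq_self)
    qed
    have "(\<Sum>(i, j)\<in>{..m} \<times> {..m}. dyadic_piece s1 s2 f i j x y) =
        (\<Sum>j\<le>m. \<Sum>i\<le>m. dyadic_piece s1 s2 f i j x y)"
      by (subst sum.swap) (rule sum.cartesian_product[symmetric])
    also have "\<dots> = f x y" using f supp(2) by (simp add: inner Dspace_iff sum_block_eq_self)
    finally show ?thesis .
  qed
  then show thesis by (intro that[of m]) simp
qed

lemma dyadic_piece_support:
  obtains R1 R2 where "0 < R1" "0 < R2"
    "\<And>(f :: 'a::euclidean_space \<Rightarrow> 'b::euclidean_space \<Rightarrow> complex) i j x y.
      dyadic_piece s1 s2 f i j x y \<noteq> 0 \<Longrightarrow> norm x \<le> R1 * 2 ^ i \<and> norm y \<le> R2 * 2 ^ j"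
proof -
  obtain R1 where R1: "0 < R1" "\<And>(h :: 'a \<Rightarrow> complex) i x. block s1 i h x \<noteq> 0 \<Longrightarrow> norm x \<le> R1 * 2 ^ i"
    by (rule block_support) blast
  obtain R2 where R2: "0 < R2" "\<And>(h :: 'b \<Rightarrow> complex) j y. block s2 j h y \<noteq> 0 \<Longrightarrow> norm y \<le> R2 * 2 ^ j"
    by (rule block_support) blast
  have "norm x \<le> R1 * 2 ^ i \<and> norm y \<le> R2 * 2 ^ j" if piece: "dyadic_piece s1 s2 f i j x y \<noteq> 0"
    for f :: "'a \<Rightarrow> 'b \<Rightarrow> complex" and i j x y
  proof
    show "norm x \<le> R1 * 2 ^ i" using piece unfolding dyadic_piece_def by (rule R1(2))
    obtain u where "block s2 j (f u) y \<noteq> 0"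
      using piece block_zero[of s1 i x] unfolding dyadic_piece_def by (metis ext)
    then show "norm y \<le> R2 * 2 ^ j" by (rule R2(2))
  qed
  with R1(1) R2(1) show thesis by (rule that)
qed

lemma weighted_norm_le_Dnorm:
  assumes f: "test_fun (\<lambda>z. f (fst z) (snd z))"
  shows "(1 + norm x) powr \<sigma>1 * (1 + norm y) powr \<sigma>2 * cmod (f x y) \<le> Dnorm \<sigma>1 \<sigma>2 f"
proof -
  let ?w = "\<lambda>z. (1 + norm (fst z)) powr \<sigma>1 * (1 + norm (snd z)) powr \<sigma>2 * cmod (f (fst z) (snd z))"
  have "continuous_on UNIV ?w"
    by (intro continuous_intros test_fun_continuous[OF f])
       (auto simp: one_plus_norm_neq_0)
  moreover have "bounded {z. ?w z \<noteq> 0}"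
    using test_fun_bounded_support[OF f] by (rule bounded_subset) auto
  ultimately have "bdd_above (range ?w)"
    by (intro bounded_imp_bdd_above bounded_range_continuous_bounded_support)
  then show ?thesis unfolding Dnorm_def using cSUP_upper[of "(x, y)" UNIV ?w] by simp
qed

lemma decay_bound_snd_slice:
  assumes "test_fun (\<lambda>z. f (fst z) (snd z))"
  shows "decay_bound \<sigma>2 (Dnorm \<sigma>1 \<sigma>2 f / (1 + norm u) powr \<sigma>1) (f u)"
  using weighted_norm_le_Dnorm[OF assms, of u \<sigma>1 _ \<sigma>2]
  by (simp add: decay_bound_def pos_le_divide_eq mult_ac one_plus_norm_neq_0)

lemma Dnorm_nonneg: "test_fun (\<lambda>z. f (fst z) (snd z)) \<Longrightarrow> 0 \<le> Dnorm \<sigma>1 \<sigma>2 f"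
  using weighted_norm_le_Dnorm[of f 0 \<sigma>1 0 \<sigma>2] order_trans[OF norm_ge_zero] by fastforce

lemma decay_bound_block_slice:
  fixes f :: "'a::euclidean_space \<Rightarrow> 'b::euclidean_space \<Rightarrow> complex"
  assumes f: "test_fun (\<lambda>z. f (fst z) (snd z))"
    and block_le: "\<And>u K. decay_bound \<sigma>2 K (f u) \<Longrightarrow>
      cmod (block s2 j (f u) y) \<le> C * K * (2 ^ j) powr (- \<sigma>2)"
  shows "decay_bound \<sigma>1 (C * Dnorm \<sigma>1 \<sigma>2 f * (2 ^ j) powr (- \<sigma>2)) (\<lambda>u. block s2 j (f u) y)"
  unfolding decay_bound_def
proof
  fix u :: 'a
  have "0 < (1 + norm u) powr \<sigma>1" by (simp add: one_plus_norm_neq_0)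
  then show "(1 + norm u) powr \<sigma>1 * cmod (block s2 j (f u) y) \<le>
      C * Dnorm \<sigma>1 \<sigma>2 f * (2 ^ j) powr (- \<sigma>2)"
    using block_le[OF decay_bound_snd_slice[OF f], of u \<sigma>1]
    by (simp add: pos_le_divide_eq mult_ac)
qed

lemma norm_dyadic_piece_le:
  assumes \<sigma>1: "real DIM('a) + real s1 < \<sigma>1" and \<sigma>2: "real DIM('b) + real s2 < \<sigma>2"
  obtains C where "0 < C"
    "\<And>(f :: 'a::euclidean_space \<Rightarrow> 'b::euclidean_space \<Rightarrow> complex) i j x y. f \<in> Dspace s1 s2 \<Longrightarrow>
      cmod (dyadic_piece s1 s2 f i j x y) \<le>
        C * Dnorm \<sigma>1 \<sigma>2 f * (2 ^ i) powr (- \<sigma>1) * (2 ^ j) powr (- \<sigma>2)"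
proof -
  obtain C1 where "0 < C1" and C1: "\<And>(h :: 'a \<Rightarrow> complex) K i x.
      test_fun h \<Longrightarrow> vanishing_moments s1 h \<Longrightarrow> decay_bound \<sigma>1 K h \<Longrightarrow>
      cmod (block s1 i h x) \<le> C1 * K * (2 ^ i) powr (- \<sigma>1)"
    by (rule norm_block_le[OF \<sigma>1]) blast
  obtain C2 where "0 < C2" and C2: "\<And>(h :: 'b \<Rightarrow> complex) K j y.
      test_fun h \<Longrightarrow> vanishing_moments s2 h \<Longrightarrow> decay_bound \<sigma>2 K h \<Longrightarrow>
      cmod (block s2 j h y) \<le> C2 * K * (2 ^ j) powr (- \<sigma>2)"
    by (rule norm_block_le[OF \<sigma>2]) blast
  show thesis
  proof (rule that[of "C1 * C2"])
    show "0 < C1 * C2" using \<open>0 < C1\<close> \<open>0 < C2\<close> by simp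
    fix f :: "'a \<Rightarrow> 'b \<Rightarrow> complex" and i j x y
    assume f: "f \<in> Dspace s1 s2"
    then have f_test: "test_fun (\<lambda>z. f (fst z) (snd z))" and f_snd: "vanishing_moments s2 (f u)" for u
      by (simp_all add: Dspace_iff)
    have "cmod (dyadic_piece s1 s2 f i j x y) \<le>
        C1 * (C2 * Dnorm \<sigma>1 \<sigma>2 f * (2 ^ j) powr (- \<sigma>2)) * (2 ^ i) powr (- \<sigma>1)"
      unfolding dyadic_piece_def
    proof (rule C1[OF _ _ decay_bound_block_slice[OF f_test C2[OF test_fun_snd_slice[OF f_test] f_snd]]])
      show "test_fun (\<lambda>u. block s2 j (f u) y)" "vanishing_moments s1 (\<lambda>u. block s2 j (f u) y)"
        using Dspace_block_snd[OF f, of j] test_fun_fst_slice[of "\<lambda>u. block s2 j (f u)" y]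
        by (simp_all add: Dspace_iff)
    qed
    then show "cmod (dyadic_piece s1 s2 f i j x y) \<le>
        C1 * C2 * Dnorm \<sigma>1 \<sigma>2 f * (2 ^ i) powr (- \<sigma>1) * (2 ^ j) powr (- \<sigma>2)"
      by (simp add: mult_ac)
  qed
qed

subsection \<open>Sublinear operators\<close>

lemma diam1_bounds:
  assumes supp: "\<And>x y. f x y \<noteq> 0 \<Longrightarrow> norm x \<le> r" and "0 \<le> r"
  shows "0 \<le> diam1 f" "diam1 f \<le> 2 * r"
proof -
  let ?S = "{dist x1 y1 | x1 y1 x2. f x1 x2 \<noteq> 0 \<and> f y1 x2 \<noteq> 0} \<union> {0}"
  have "dist x1 y1 \<le> 2 * r" if "f x1 x2 \<noteq> 0" "f y1 x2 \<noteq> 0" for x1 y1 x2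
    using supp[OF that(1)] supp[OF that(2)] norm_triangle_ineq4[of x1 y1] by (simp add: dist_norm)
  then have dist_le: "d \<le> 2 * r" if "d \<in> ?S" for d using that \<open>0 \<le> r\<close> by auto
  then have "bdd_above ?S" by (rule bdd_aboveI)
  then show "0 \<le> diam1 f" unfolding diam1_def by (intro cSup_upper) auto
  show "diam1 f \<le> 2 * r" unfolding diam1_def by (rule cSup_least) (use dist_le in auto)
qed

lemma diam2_eq_diam1: "diam2 f = diam1 (\<lambda>y x. f x y)"
  by (simp add: diam1_def diam2_def)

lemma sup_norm_bounds:
  assumes "\<And>x y. cmod (f x y) \<le> M"
  shows "0 \<le> sup_norm f" "sup_norm f \<le> M"
proof -
  have "bdd_above (range (\<lambda>z. cmod (f (fst z) (snd z))))" using assms by (auto intro!: bdd_aboveI2)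
  then have "cmod (f undefined undefined) \<le> sup_norm f"
    unfolding sup_norm_def using cSUP_upper[of "(undefined, undefined)" UNIV] by fastforce
  then show "0 \<le> sup_norm f" using norm_ge_zero order_trans by blast
  show "sup_norm f \<le> M" unfolding sup_norm_def by (rule cSUP_least) (auto simp: assms)
qed

lemma diam_powr_sup_norm_le:
  assumes supp: "\<And>x y. f x y \<noteq> 0 \<Longrightarrow> norm x \<le> r1 \<and> norm y \<le> r2"
    and bound: "\<And>x y. cmod (f x y) \<le> M" and "0 \<le> r1" "0 \<le> r2" "0 \<le> e1" "0 \<le> e2"
  shows "diam1 f powr e1 * diam2 f powr e2 * sup_norm f \<le> (2 * r1) powr e1 * (2 * r2) powr e2 * M"
proof -
  have "0 \<le> diam1 f" "diam1 f \<le> 2 * r1" using diam1_bounds[of f r1] supp \<open>0 \<le> r1\<close> by auto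
  moreover have "0 \<le> diam2 f" "diam2 f \<le> 2 * r2"
    using diam1_bounds[of "\<lambda>y x. f x y" r2] supp \<open>0 \<le> r2\<close> by (auto simp: diam2_eq_diam1)
  ultimately show ?thesis
    using sup_norm_bounds[of f, OF bound] \<open>0 \<le> e1\<close> \<open>0 \<le> e2\<close> by (intro mult_mono powr_mono2) auto
qed

lemma sublinear_add_powr_le:
  assumes T: "Bq_sublinear q N T Y" and q: "0 < q" and N: "\<And>v. 0 \<le> N v" and fg: "f \<in> Y" "g \<in> Y"
  shows "N (T (\<lambda>x y. f x y + g x y)) powr q \<le> N (T f) powr q + N (T g) powr q"
proof -
  have "N (T (\<lambda>x y. 1 * f x y + 1 * g x y)) \<le>
      (cmod 1 powr q * N (T f) powr q + cmod 1 powr q * N (T g) powr q) powr (1 / q)"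
    using T fg unfolding Bq_sublinear_def by blast
  then have "N (T (\<lambda>x y. f x y + g x y)) powr q \<le>
      ((N (T f) powr q + N (T g) powr q) powr (1 / q)) powr q"
    using N q by (intro powr_mono2) auto
  then show ?thesis using q by (simp add: powr_powr)
qed

lemma sublinear_zero_eq_0:
  assumes T: "Bq_sublinear q N T Y" and N: "\<And>v. 0 \<le> N v" and zero: "(\<lambda>x y. 0) \<in> Y"
  shows "N (T (\<lambda>x y. 0)) = 0"
proof -
  have "N (T (\<lambda>x y. 0 * 0 + 0 * 0)) \<le> (cmod 0 powr q * N (T (\<lambda>x y. 0)) powr q +
      cmod 0 powr q * N (T (\<lambda>x y. 0)) powr q) powr (1 / q)"
    using T[unfolded Bq_sublinear_def, rule_format, OF zero zero, of 0 0] by (rule conjunct1)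
  then show ?thesis using N[of "T (\<lambda>x y. 0)"] by simp
qed

lemma sublinear_sum_powr_le:
  assumes T: "Bq_sublinear q N T Y" and q: "0 < q" and N: "\<And>v. 0 \<le> N v"
    and zero: "(\<lambda>x y. 0) \<in> Y" and add: "\<And>f g. f \<in> Y \<Longrightarrow> g \<in> Y \<Longrightarrow> (\<lambda>x y. f x y + g x y) \<in> Y"
    and F: "\<And>k. k \<in> A \<Longrightarrow> F k \<in> Y"
  shows "N (T (\<lambda>x y. \<Sum>k\<in>A. F k x y)) powr q \<le> (\<Sum>k\<in>A. N (T (F k)) powr q)"
proof -
  have "(\<lambda>x y. \<Sum>k\<in>A. F k x y) \<in> Y \<and>
      N (T (\<lambda>x y. \<Sum>k\<in>A. F k x y)) powr q \<le> (\<Sum>k\<in>A. N (T (F k)) powr q)"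
    using F
  proof (induction A rule: infinite_finite_induct)
    case (insert k A)
    then have "F k \<in> Y" "(\<lambda>x y. \<Sum>k\<in>A. F k x y) \<in> Y" by simp_all
    from sublinear_add_powr_le[OF T q N this] add[OF this] insert show ?case by fastforce
  qed (simp_all add: zero sublinear_zero_eq_0[OF T N zero])
  then show ?thesis ..
qed

lemma sublinear_powr_le_sum_dyadic_piece:
  assumes T: "Bq_sublinear q N T (Dspace s1 s2)" and q: "0 < q" and N: "\<And>v. 0 \<le> N v"
    and f: "f \<in> Dspace s1 s2"
  obtains m where
    "N (T f) powr q \<le> (\<Sum>(i, j)\<in>{..m} \<times> {..m}. N (T (dyadic_piece s1 s2 f i j)) powr q)"
proof -
  obtain m where m: "f = (\<lambda>x y. \<Sum>(i, j)\<in>{..m} \<times> {..m}. dyadic_piece s1 s2 f i j x y)"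
    by (rule eq_sum_dyadic_piece[OF f])
  have "N (T (\<lambda>x y. \<Sum>k\<in>{..m} \<times> {..m}. dyadic_piece s1 s2 f (fst k) (snd k) x y)) powr q \<le>
      (\<Sum>k\<in>{..m} \<times> {..m}. N (T (dyadic_piece s1 s2 f (fst k) (snd k))) powr q)"
    by (rule sublinear_sum_powr_le[OF T q N Dspace_zero Dspace_add Dspace_dyadic_piece[OF f]])
  then show thesis
    unfolding m[unfolded case_prod_unfold, symmetric] by (rule that[unfolded case_prod_unfold])
qed

lemma le_if_powr_le_double_geometric_sum:
  fixes c :: "nat \<Rightarrow> nat \<Rightarrow> real"
  assumes q: "0 < q" and ratios: "0 \<le> a" "a < 1" "0 \<le> b" "b < 1"
    and "0 \<le> M" "0 \<le> t" "finite A" "finite B"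
    and terms: "\<And>i j. 0 \<le> c i j" "\<And>i j. c i j \<le> M * a ^ i * b ^ j"
    and powr_le_sum: "t powr q \<le> (\<Sum>(i, j)\<in>A \<times> B. c i j powr q)"
  shows "t \<le> (1 / (1 - a powr q) * (1 / (1 - b powr q))) powr (1 / q) * M"
proof -
  define W where "W = 1 / (1 - a powr q) * (1 / (1 - b powr q))"
  have less_1: "a powr q < 1" "b powr q < 1"
    using powr_less_mono2[OF q, of a 1] powr_less_mono2[OF q, of b 1] ratios by simp_all
  have "c i j powr q \<le> M powr q * ((a powr q) ^ i * (b powr q) ^ j)" for i j
    using powr_mono2[OF _ terms, of q i j] q by (simp add: powr_mult power_powr mult.assoc)
  then have "t powr q \<le> (\<Sum>(i, j)\<in>A \<times> B. M powr q * ((a powr q) ^ i * (b powr q) ^ j))"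
    by (intro order_trans[OF powr_le_sum] sum_mono) auto
  also have "\<dots> = M powr q * ((\<Sum>i\<in>A. (a powr q) ^ i) * (\<Sum>j\<in>B. (b powr q) ^ j))"
    by (simp only: sum_product sum.cartesian_product sum_distrib_left[of "M powr q"]
        case_prod_unfold)
  also have "\<dots> \<le> M powr q * W"
    unfolding W_def using less_1 \<open>finite A\<close> \<open>finite B\<close>
    by (intro mult_left_mono mult_mono sum_geometric_le sum_nonneg) auto
  finally have "(t powr q) powr (1 / q) \<le> (M powr q * W) powr (1 / q)"
    using q by (intro powr_mono2) auto
  then have "t \<le> W powr (1 / q) * M"
    using q \<open>0 \<le> M\<close> \<open>0 \<le> t\<close> by (simp add: powr_powr powr_mult mult.commute)
  then show ?thesis by (simp only: W_def)
qed

lemma operator_dyadic_piece_le: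
  fixes T :: "('a::euclidean_space \<Rightarrow> 'b::euclidean_space \<Rightarrow> complex) \<Rightarrow> 'v" and N :: "'v \<Rightarrow> real"
  assumes \<sigma>: "real DIM('a) + real s1 < \<sigma>1" "real DIM('b) + real s2 < \<sigma>2"
    and exponents: "0 \<le> e1" "0 \<le> e2" and "0 < C"
    and T: "\<And>f. f \<in> Dspace s1 s2 \<Longrightarrow> N (T f) \<le> C * diam1 f powr e1 * diam2 f powr e2 * sup_norm f"
  obtains A where "0 < A"
    "\<And>f i j. f \<in> Dspace s1 s2 \<Longrightarrow> N (T (dyadic_piece s1 s2 f i j)) \<le>
      A * Dnorm \<sigma>1 \<sigma>2 f * (2 powr (e1 - \<sigma>1)) ^ i * (2 powr (e2 - \<sigma>2)) ^ j"
proof -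
  obtain R1 R2 where R: "0 < R1" "0 < R2"
    and supp: "\<And>(f :: 'a \<Rightarrow> 'b \<Rightarrow> complex) i j x y.
      dyadic_piece s1 s2 f i j x y \<noteq> 0 \<Longrightarrow> norm x \<le> R1 * 2 ^ i \<and> norm y \<le> R2 * 2 ^ j"
    by (rule dyadic_piece_support) blast
  obtain C' where "0 < C'" and bound: "\<And>(f :: 'a \<Rightarrow> 'b \<Rightarrow> complex) i j x y. f \<in> Dspace s1 s2 \<Longrightarrow>
      cmod (dyadic_piece s1 s2 f i j x y) \<le>
        C' * Dnorm \<sigma>1 \<sigma>2 f * (2 ^ i) powr (- \<sigma>1) * (2 ^ j) powr (- \<sigma>2)"
    by (rule norm_dyadic_piece_le[OF \<sigma>]) blast
  have scale: "(2 * (R * 2 ^ i)) powr e * (2 ^ i) powr (- \<sigma>) = (2 * R) powr e * (2 powr (e - \<sigma>)) ^ i"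
    for R e \<sigma> :: real and i :: nat
    by (simp add: powr_mult powr_diff powr_minus power_powr power_mult_distrib power_inverse
        divide_inverse)
  show thesis
  proof (rule that[of "C * (2 * R1) powr e1 * (2 * R2) powr e2 * C'"])
    show "0 < C * (2 * R1) powr e1 * (2 * R2) powr e2 * C'" using \<open>0 < C\<close> \<open>0 < C'\<close> R by simp
    fix f :: "'a \<Rightarrow> 'b \<Rightarrow> complex" and i j
    assume f: "f \<in> Dspace s1 s2"
    let ?g = "dyadic_piece s1 s2 f i j" and ?D = "Dnorm \<sigma>1 \<sigma>2 f"
    have "N (T ?g) \<le> C * (diam1 ?g powr e1 * diam2 ?g powr e2 * sup_norm ?g)"
      using T[OF Dspace_dyadic_piece[OF f]] by (simp add: mult.assoc)
    also have "\<dots> \<le> C * ((2 * (R1 * 2 ^ i)) powr e1 * (2 * (R2 * 2 ^ j)) powr e2 *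
        (C' * ?D * (2 ^ i) powr (- \<sigma>1) * (2 ^ j) powr (- \<sigma>2)))"
      using \<open>0 < C\<close> R exponents supp bound[OF f]
      by (intro mult_left_mono diam_powr_sup_norm_le) auto
    also have "\<dots> = C * C' * ?D * ((2 * (R1 * 2 ^ i)) powr e1 * (2 ^ i) powr (- \<sigma>1)) *
        ((2 * (R2 * 2 ^ j)) powr e2 * (2 ^ j) powr (- \<sigma>2))"
      by (simp add: mult_ac)
    finally show "N (T ?g) \<le> C * (2 * R1) powr e1 * (2 * R2) powr e2 * C' * ?D *
        (2 powr (e1 - \<sigma>1)) ^ i * (2 powr (e2 - \<sigma>2)) ^ j"
      unfolding scale by (simp add: mult_ac)
  qed
qed

lemma sublinear_le_Dnorm_if_diam_bound:
  fixes T :: "('a::euclidean_space \<Rightarrow> 'b::euclidean_space \<Rightarrow> complex) \<Rightarrow> 'v::ab_group_add"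
  assumes sublinear: "Bq_sublinear q N T (Dspace s1 s2)" and q: "0 < q" and N: "\<And>v. 0 \<le> N v"
    and \<sigma>: "real DIM('a) + real s1 < \<sigma>1" "real DIM('b) + real s2 < \<sigma>2"
    and exponents: "0 \<le> e1" "0 \<le> e2" "e1 < \<sigma>1" "e2 < \<sigma>2" and "0 < C"
    and T: "\<And>f. f \<in> Dspace s1 s2 \<Longrightarrow> N (T f) \<le> C * diam1 f powr e1 * diam2 f powr e2 * sup_norm f"
  shows "\<exists>C'>0. \<forall>f\<in>Dspace s1 s2. N (T f) \<le> C' * Dnorm \<sigma>1 \<sigma>2 f"
proof -
  define a b where "a = 2 powr (e1 - \<sigma>1)" and "b = 2 powr (e2 - \<sigma>2)"
  obtain A where "0 < A" and A: "\<And>f i j. f \<in> Dspace s1 s2 \<Longrightarrow>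
      N (T (dyadic_piece s1 s2 f i j)) \<le> A * Dnorm \<sigma>1 \<sigma>2 f * a ^ i * b ^ j"
    using operator_dyadic_piece_le[OF \<sigma> exponents(1,2) \<open>0 < C\<close>, of N T, OF T]
    unfolding a_def b_def by blast
  have ratios: "0 \<le> a" "a < 1" "0 \<le> b" "b < 1"
    using exponents by (simp_all add: a_def b_def powr_less_one)
  let ?W = "(1 / (1 - a powr q) * (1 / (1 - b powr q))) powr (1 / q)"
  have "N (T f) \<le> ?W * (A * Dnorm \<sigma>1 \<sigma>2 f)" if f: "f \<in> Dspace s1 s2" for f
  proof -
    obtain m where powr_le_sum: "N (T f) powr q \<le>
        (\<Sum>(i, j)\<in>{..m} \<times> {..m}. N (T (dyadic_piece s1 s2 f i j)) powr q)"
      by (rule sublinear_powr_le_sum_dyadic_piece[OF sublinear q N f])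
    have "0 \<le> A * Dnorm \<sigma>1 \<sigma>2 f" using f \<open>0 < A\<close> by (simp add: Dspace_iff Dnorm_nonneg)
    then show ?thesis
      by (rule le_if_powr_le_double_geometric_sum[OF q ratios _ N _ _ N A[OF f] powr_le_sum]) simp_all
  qed
  moreover have "a powr q < 1" "b powr q < 1"
    using powr_less_mono2[OF q, of a 1] powr_less_mono2[OF q, of b 1] ratios by simp_all
  ultimately show ?thesis using \<open>0 < A\<close> by (intro exI[of _ "?W * A"]) (simp add: mult.assoc)
qed

theorem lemma2p4:
  fixes p q :: real and sc :: "complex \<Rightarrow> 'v::ab_group_add \<Rightarrow> 'v" and N :: "'v \<Rightarrow> real"
    and s1 s2 :: nat and \<sigma>1 \<sigma>2 :: real
    and T :: "('a::euclidean_space \<Rightarrow> 'b::euclidean_space \<Rightarrow> complex) \<Rightarrow> 'v"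
  assumes "0 < p" "p \<le> 1" "p \<le> q" "q \<le> 1"
    and "q_quasi_banach q sc N"
    and "max (real DIM('a) / p) (real DIM('a) + real s1) < \<sigma>1" "\<sigma>1 < real DIM('a) + real s1 + 1"
    and "max (real DIM('b) / p) (real DIM('b) + real s2) < \<sigma>2" "\<sigma>2 < real DIM('b) + real s2 + 1"
    and "Bq_sublinear q N T (Dspace s1 s2)"
    and "\<exists>C>0. \<forall>f\<in>Dspace s1 s2.
           N (T f) \<le> C * diam1 f powr (real DIM('a) / p) * diam2 f powr (real DIM('b) / p) * sup_norm f"
  shows "\<exists>C'>0. \<forall>f\<in>Dspace s1 s2. N (T f) \<le> C' * Dnorm \<sigma>1 \<sigma>2 f"
proof -
  have "0 < q" "\<And>v. 0 \<le> N v" using assms(5) by (auto simp: q_quasi_banach_def)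
  moreover have "real DIM('a) + real s1 < \<sigma>1" "real DIM('b) + real s2 < \<sigma>2"
    "0 \<le> real DIM('a) / p" "0 \<le> real DIM('b) / p" "real DIM('a) / p < \<sigma>1" "real DIM('b) / p < \<sigma>2"
    using assms by simp_all
  moreover obtain C where "0 < C" "\<And>f. f \<in> Dspace s1 s2 \<Longrightarrow>
      N (T f) \<le> C * diam1 f powr (real DIM('a) / p) * diam2 f powr (real DIM('b) / p) * sup_norm f"
    using assms(11) by blast
  ultimately show ?thesis by (rule sublinear_le_Dnorm_if_diam_bound[OF assms(10)])
qed

end
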